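(* If $f:\mathbb{H}\to\mathbb{R}$ is a smooth function with compact support on the Heisenberg group, then, uniformly, for $A=X,Y,Z$, $$\lim_{c\to+\infty}A^cf=\lim_{c\to+\infty}\tilde A^cf=A_{\mathbb{H}}f,$$ and, uniformly, $$\lim_{c\to+\infty}L^cf=\lim_{c\to+\infty}\tilde L^cf=L_{\mathbb{H}}f.$$ Here $X^c,Y^c,Z^c,L^c$ and $\tilde X^c,\tilde Y^c,\tilde Z^c,\tilde L^c$ are the dilated vector fields and sublaplacians of $\mathbf{SL}(2,\mathbb{R})$ and of its universal covering $\widetilde{\mathbf{SL}(2,\mathbb{R})}$.
   Context: The Heisenberg group $\mathbb{H}$ is $\mathbb{R}^3$ with the law $(x_1,y_1,z_1)(x_2,y_2,z_2)=(x_1+x_2,y_1+y_2,z_1+z_2+x_1y_2-x_2y_1)$. In cylindrical coordinates $x=r\cos\theta$, $y=r\sin\theta$, set $X_{\mathbb{H}}=\cos\theta\,\partial_r-\frac{\sin\theta}{r}\partial_\theta-r\sin\theta\,\partial_z$, $Y_{\mathbb{H}}=\sin\theta\,\partial_r+\frac{\cos\theta}{r}\partial_\theta+r\cos\theta\,\partial_z$, $Z_{\mathbb{H}}=\partial_z$, $L_{\mathbb{H}}=X_{\mathbb{H}}^2+Y_{\mathbb{H}}^2$. Let $\tilde X,\tilde Y,\tilde Z$ be the left-invariant vector fields on $\widetilde{\mathbf{SL}(2,\mathbb{R})}$ generated by the matrices $X=\begin{pmatrix}1&0\\0&-1\end{pmatrix}$, $Y=\begin{pmatrix}0&1\\1&0\end{pmatrix}$,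 $Z=\begin{pmatrix}0&1\\-1&0\end{pmatrix}$. Via $\exp(r\cos\theta\,\tilde X+r\sin\theta\,\tilde Y)\exp(z\tilde Z)\mapsto(r,\theta,z)$ ($z\in\mathbb{R}$) they are regarded as first order differential operators acting on smooth functions on $\mathbb{H}$; in cylindrical coordinates $\tilde X=\cos(\theta+2z)\partial_r-\sin(\theta+2z)\left(\tanh r\,\partial_z+\left(\frac{1}{\tanh r}-\tanh r\right)\partial_\theta\right)$, $\tilde Y=\sin(\theta+2z)\partial_r+\cos(\theta+2z)\left(\tanh r\,\partial_z+\left(\frac1{\tanh r}-\tanh r\right)\partial_\theta\right)$, $\tilde Z=\partial_z$. With the dilation field $D=r\partial_r+2z\partial_z$ and $c\ge1$, the dilated fields are $\tilde A^c=\frac{1}{\sqrt c}e^{-\frac12\ln c\,D}\tilde Ae^{\frac12\ln c\,D}$ for $\tilde A=\tilde X,\tilde Y$, and $\tilde Z^c=\frac1c e^{-\frac12\ln c\,D}\tilde Ze^{\frac12\ln c\,D}=\partial_z$; explicitly $$\tilde X^c=\cos\left(\theta+\tfrac{2z}{c}\right)\partial_r-\sin\left(\theta+\tfrac{2z}{c}\right)\left(\sqrt c\tanh\tfrac{r}{\sqrt c}\,\partial_z+\left(\tfrac{1}{\sqrt c\tanh\frac{r}{\sqrt c}}-\tfrac{\tanh\frac{r}{\sqrt c}}{\sqrt c}\right)\partial_\theta\right),$$ $$\tilde Y^c=\sin\left(\theta+\tfrac{2z}{c}\right)\partial_r+\cos\left(\theta+\tfrac{2z}{c}\right)\left(\sqrt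 c\tanh\tfrac{r}{\sqrt c}\,\partial_z+\left(\tfrac{1}{\sqrt c\tanh\frac{r}{\sqrt c}}-\tfrac{\tanh\frac{r}{\sqrt c}}{\sqrt c}\right)\partial_\theta\right),$$ and $\tilde L^c=(\tilde X^c)^2+(\tilde Y^c)^2$. For $\mathbf{SL}(2,\mathbb{R})$, where the coordinate $z$ ranges over $[-\pi,\pi]$ (and is periodic), $X^c,Y^c,Z^c$, $L^c=(X^c)^2+(Y^c)^2$ are given by the same formulas on the box $[0,\infty)\times[0,2\pi]\times[-\sqrt c\,\pi,\sqrt c\,\pi]$; thus for compactly supported $f$ on $\mathbb{H}$, $X^cf,Y^cf,Z^cf,L^cf$ are defined as soon as $c$ is large enough. *)

theory Defs
  imports "HOL-Analysis.Analysis"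
begin

text \<open>The Heisenberg group enters only through its underlying manifold \<open>\<real>\<^sup>3\<close>, with Cartesian
  coordinates \<open>(x, y, z)\<close>, its vector fields and its dilations.\<close>

type_synonym heis = "real \<times> real \<times> real"

primrec Ck :: "nat \<Rightarrow> (heis \<Rightarrow> real) \<Rightarrow> bool" where
  "Ck 0 f \<longleftrightarrow> continuous_on UNIV f"
| "Ck (Suc k) f \<longleftrightarrow>
     (\<forall>p. f differentiable (at p)) \<and> (\<forall>v. Ck k (\<lambda>p. frechet_derivative f (at p) v))"

definition smooth :: "(heis \<Rightarrow> real) \<Rightarrow> bool" where
  "smooth f \<longleftrightarrow> (\<forall>k. Ck k f)"

definition compact_support :: "(heis \<Rightarrow> real) \<Rightarrow> bool" where
  "compact_support f \<longleftrightarrow> compact (closure {p. f p \<noteq> 0})"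

type_synonym diff_op = "(heis \<Rightarrow> real) \<Rightarrow> heis \<Rightarrow> real"

definition field_op :: "(heis \<Rightarrow> heis) \<Rightarrow> diff_op" where
  "field_op V f p = frechet_derivative f (at p) (V p)"

definition sum_of_squares :: "diff_op \<Rightarrow> diff_op \<Rightarrow> diff_op" where
  "sum_of_squares S T f p = S (S f) p + T (T f) p"

subsection \<open>The Heisenberg group\<close>

text \<open>In Cartesian coordinates the fields are \<open>\<partial>\<^sub>x - y \<partial>\<^sub>z\<close>, \<open>\<partial>\<^sub>y + x \<partial>\<^sub>z\<close> and \<open>\<partial>\<^sub>z\<close>, which also
  makes sense on the axis \<open>r = 0\<close>; the lemmas below give their cylindrical form off the axis.\<close>

definition X_heis :: diff_op where "X_heis = field_op (\<lambda>(x, y, z). (1, 0, - y))"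
definition Y_heis :: diff_op where "Y_heis = field_op (\<lambda>(x, y, z). (0, 1, x))"
definition Z_heis :: diff_op where "Z_heis = field_op (\<lambda>(x, y, z). (0, 0, 1))"
definition L_heis :: diff_op where "L_heis = sum_of_squares X_heis Y_heis"

definition cyl :: "real \<Rightarrow> real \<Rightarrow> real \<Rightarrow> heis" where
  "cyl r \<theta> z = (r * cos \<theta>, r * sin \<theta>, z)"

lemma deriv_cyl:
  assumes "f differentiable (at (cyl r \<theta> z))"
  shows "deriv (\<lambda>r. f (cyl r \<theta> z)) r = frechet_derivative f (at (cyl r \<theta> z)) (cos \<theta>, sin \<theta>, 0)"
    and "deriv (\<lambda>\<theta>. f (cyl r \<theta> z)) \<theta> =
           frechet_derivative f (at (cyl r \<theta> z)) (- r * sin \<theta>, r * cos \<theta>, 0)"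
    and "deriv (\<lambda>z. f (cyl r \<theta> z)) z = frechet_derivative f (at (cyl r \<theta> z)) (0, 0, 1)"
proof -
  let ?D = "frechet_derivative f (at (cyl r \<theta> z))"
  have D: "(f has_derivative ?D) (at (cyl r \<theta> z))"
    using assms frechet_derivative_works by blast
  have chain: "deriv (\<lambda>t. f (g t)) s = ?D v"
    if "(g has_vector_derivative v) (at s)" "g s = cyl r \<theta> z" for g s v
  proof -
    have "((f \<circ> g) has_vector_derivative ?D v) (at s)"
      using vector_derivative_diff_chain_within[of g v s UNIV f ?D] that D
      by (simp add: has_derivative_at_withinI)
    then show ?thesis
      by (auto simp: o_def has_real_derivative_iff_has_vector_derivative intro: DERIV_imp_deriv)
  qed
  show "deriv (\<lambda>r. f (cyl r \<theta> z)) r = ?D (cos \<theta>, sin \<theta>, 0)"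
    by (rule chain) (auto simp: cyl_def has_vector_derivative_def
        intro!: derivative_eq_intros)
  show "deriv (\<lambda>\<theta>. f (cyl r \<theta> z)) \<theta> = ?D (- r * sin \<theta>, r * cos \<theta>, 0)"
    by (rule chain) (auto simp: cyl_def has_vector_derivative_def
        intro!: derivative_eq_intros)
  show "deriv (\<lambda>z. f (cyl r \<theta> z)) z = ?D (0, 0, 1)"
    by (rule chain) (auto simp: cyl_def has_vector_derivative_def
        intro!: derivative_eq_intros)
qed

lemma heis_cylindrical:
  assumes "r \<noteq> 0" and f: "f differentiable (at (cyl r \<theta> z))"
  shows "X_heis f (cyl r \<theta> z) = cos \<theta> * deriv (\<lambda>r. f (cyl r \<theta> z)) r
           - sin \<theta> / r * deriv (\<lambda>\<theta>. f (cyl r \<theta> z)) \<theta>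
           - r * sin \<theta> * deriv (\<lambda>z. f (cyl r \<theta> z)) z"
    and "Y_heis f (cyl r \<theta> z) = sin \<theta> * deriv (\<lambda>r. f (cyl r \<theta> z)) r
           + cos \<theta> / r * deriv (\<lambda>\<theta>. f (cyl r \<theta> z)) \<theta>
           + r * cos \<theta> * deriv (\<lambda>z. f (cyl r \<theta> z)) z"
    and "Z_heis f (cyl r \<theta> z) = deriv (\<lambda>z. f (cyl r \<theta> z)) z"
proof -
  let ?D = "frechet_derivative f (at (cyl r \<theta> z))"
  have lin: "linear ?D"
    using f by (rule linear_frechet_derivative)
  have comb: "a * ?D u + b * ?D v + c * ?D w = ?D (a *\<^sub>R u + b *\<^sub>R v + c *\<^sub>R w)" for a b c u v w
    using lin by (simp add: linear_add linear_scale)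
  have sc: "cos \<theta> * cos \<theta> + sin \<theta> * sin \<theta> = 1"
    using sin_cos_squared_add2[of \<theta>] by (simp add: power2_eq_square)
  show "X_heis f (cyl r \<theta> z) = cos \<theta> * deriv (\<lambda>r. f (cyl r \<theta> z)) r
           - sin \<theta> / r * deriv (\<lambda>\<theta>. f (cyl r \<theta> z)) \<theta>
           - r * sin \<theta> * deriv (\<lambda>z. f (cyl r \<theta> z)) z"
    using comb[of "cos \<theta>" "(cos \<theta>, sin \<theta>, 0)" "- sin \<theta> / r" "(- r * sin \<theta>, r * cos \<theta>, 0)"
        "- r * sin \<theta>" "(0, 0, 1)"] assms(1) sc
    unfolding deriv_cyl[OF f] by (simp add: X_heis_def field_op_def cyl_def)
  show "Y_heis f (cyl r \<theta> z) = sin \<theta> * deriv (\<lambda>r. f (cyl r \<theta> z)) r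
           + cos \<theta> / r * deriv (\<lambda>\<theta>. f (cyl r \<theta> z)) \<theta>
           + r * cos \<theta> * deriv (\<lambda>z. f (cyl r \<theta> z)) z"
    using comb[of "sin \<theta>" "(cos \<theta>, sin \<theta>, 0)" "cos \<theta> / r" "(- r * sin \<theta>, r * cos \<theta>, 0)"
        "r * cos \<theta>" "(0, 0, 1)"] assms(1) sc
    unfolding deriv_cyl[OF f] by (simp add: Y_heis_def field_op_def cyl_def algebra_simps)
  show "Z_heis f (cyl r \<theta> z) = deriv (\<lambda>z. f (cyl r \<theta> z)) z"
    unfolding deriv_cyl[OF f] by (simp add: Z_heis_def field_op_def cyl_def)
qed

subsection \<open>\<open>SL(2,\<real>)\<close> and its universal covering\<close>

type_synonym mat2 = "real^2^2"

definition matX :: mat2 where "matX = vector [vector [1, 0], vector [0, - 1]]"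
definition matY :: mat2 where "matY = vector [vector [0, 1], vector [1, 0]]"
definition matZ :: mat2 where "matZ = vector [vector [0, 1], vector [- 1, 0]]"

text \<open>The type \<^typ>\<open>mat2\<close> carries the componentwise product, so \<^const>\<open>exp\<close> and \<open>^\<close> are not
  available for the matrix product.\<close>

definition mexp :: "mat2 \<Rightarrow> mat2" where
  "mexp A = (\<Sum>k. (1 / fact k) *\<^sub>R (((**) A ^^ k) (mat 1)))"

text \<open>The map \<open>exp (x X + y Y) exp (z Z)\<close>. It covers \<open>SL(2,\<real>)\<close>, and as \<open>\<real>\<^sup>3\<close> is simply
  connected, \<open>\<real>\<^sup>3\<close> with this map is the universal covering; the coordinates \<open>(x, y, z)\<close> on it
  are the ones given by the exponentials in the covering group.\<close>

definition sl2_map :: "heis \<Rightarrow> mat2" where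
  "sl2_map = (\<lambda>(x, y, z). mexp (x *\<^sub>R matX + y *\<^sub>R matY) ** mexp (z *\<^sub>R matZ))"

text \<open>The left-invariant field on the covering generated by \<open>A\<close> is the lift, through the local
  diffeomorphism \<^const>\<open>sl2_map\<close>, of the left-invariant field \<open>M \<mapsto> M A\<close> on \<open>SL(2,\<real>)\<close>.\<close>

definition cover_field :: "mat2 \<Rightarrow> heis \<Rightarrow> heis" where
  "cover_field A p = (THE v. frechet_derivative sl2_map (at p) v = sl2_map p ** A)"

definition cover_op :: "mat2 \<Rightarrow> diff_op" where
  "cover_op A = field_op (cover_field A)"

text \<open>On \<open>SL(2,\<real>)\<close> itself \<open>z\<close> is only defined modulo \<open>2 \<pi>\<close>. A function of the coordinates with
  \<open>- \<pi> < z \<le> \<pi>\<close> is regarded as a function on the group, differentiated at \<open>M\<close> along the curve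
  \<open>M exp (t A)\<close>, and the result is read at \<open>M = sl2_map p\<close>, which is periodic in \<open>z\<close>.\<close>

definition sl2_coord :: "mat2 \<Rightarrow> heis" where
  "sl2_coord M = (THE p. sl2_map p = M \<and> - pi < snd (snd p) \<and> snd (snd p) \<le> pi)"

definition sl2_op :: "mat2 \<Rightarrow> diff_op" where
  "sl2_op A f p = deriv (\<lambda>t. f (sl2_coord (sl2_map p ** mexp (t *\<^sub>R A)))) 0"

subsection \<open>Dilations\<close>

text \<open>The operator \<open>e\<^bsup>t D\<^esup>\<close>, \<open>D = r \<partial>\<^sub>r + 2 z \<partial>\<^sub>z = x \<partial>\<^sub>x + y \<partial>\<^sub>y + 2 z \<partial>\<^sub>z\<close>: composition with the
  flow of \<open>D\<close> at time \<open>t\<close>.\<close>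

definition exp_dil :: "real \<Rightarrow> diff_op" where
  "exp_dil t f = (\<lambda>(x, y, z). f (exp t * x, exp t * y, exp (2 * t) * z))"

definition conj_dil :: "real \<Rightarrow> diff_op \<Rightarrow> diff_op" where
  "conj_dil c T f = exp_dil (- (1/2) * ln c) (T (exp_dil (1/2 * ln c) f))"

definition X_cover :: "real \<Rightarrow> diff_op" where
  "X_cover c f p = 1 / sqrt c * conj_dil c (cover_op matX) f p"
definition Y_cover :: "real \<Rightarrow> diff_op" where
  "Y_cover c f p = 1 / sqrt c * conj_dil c (cover_op matY) f p"
definition Z_cover :: "real \<Rightarrow> diff_op" where
  "Z_cover c f p = 1 / c * conj_dil c (cover_op matZ) f p"
definition L_cover :: "real \<Rightarrow> diff_op" where
  "L_cover c = sum_of_squares (X_cover c) (Y_cover c)"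

definition X_sl2 :: "real \<Rightarrow> diff_op" where
  "X_sl2 c f p = 1 / sqrt c * conj_dil c (sl2_op matX) f p"
definition Y_sl2 :: "real \<Rightarrow> diff_op" where
  "Y_sl2 c f p = 1 / sqrt c * conj_dil c (sl2_op matY) f p"
definition Z_sl2 :: "real \<Rightarrow> diff_op" where
  "Z_sl2 c f p = 1 / c * conj_dil c (sl2_op matZ) f p"
definition L_sl2 :: "real \<Rightarrow> diff_op" where
  "L_sl2 c = sum_of_squares (X_sl2 c) (Y_sl2 c)"

text \<open>The operators of \<open>SL(2,\<real>)\<close> live on boxes that depend on \<open>c\<close> and exhaust \<open>\<real>\<^sup>3\<close>; uniform
  convergence is on these boxes.\<close>

definition sl2_box :: "real \<Rightarrow> heis set" where
  "sl2_box c = {(x, y, z). - sqrt c * pi \<le> z \<and> z \<le> sqrt c * pi}"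

definition uniform_limit_on_boxes :: "(real \<Rightarrow> heis \<Rightarrow> real) \<Rightarrow> (heis \<Rightarrow> real) \<Rightarrow> bool" where
  "uniform_limit_on_boxes F g \<longleftrightarrow>
     (\<forall>\<epsilon>>0. \<forall>\<^sub>F c in at_top. \<forall>p\<in>sl2_box c. dist (F c p) (g p) < \<epsilon>)"

end

theory Submission
  imports Defs
begin

text \<open>Put \<open>s = 1 / sqrt c\<close>. Solving for the left-invariant field in the coordinates \<open>(x, y, z)\<close> shows that
  its dilation by \<open>c\<close> is a field \<open>W s\<close> whose coefficients are jointly continuous, together with their
  derivatives in the point, in \<open>s\<close> and the point, including at \<open>s = 0\<close> and on the axis \<open>r = 0\<close>; and \<open>W 0\<close> is
  the Heisenberg field. Hence \<open>W s f\<close> and \<open>W s (W s f)\<close> are jointly continuous and vanish off the support of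
  \<open>f\<close>, so uniform continuity on \<open>[0, 1] \<times> supp f\<close> gives the limits on the covering. On \<open>SL(2,\<real>)\<close> the
  operators agree with those of the covering where \<open>\<bar>z\<bar> < c \<pi>\<close>, because there the polar decomposition
  inverts the coordinate map continuously.\<close>

subsection \<open>Hyperbolic functions of a square root\<close>

text \<open>The explicit fields contain quotients such as tanh r / r and r / tanh r, singular in
  form on the axis. All of them are even in r, so they are functions of q = r^2, and the entire
  series below, cosh (sqrt q) and sinh (sqrt q) / sqrt q, make them smooth across the axis. At q < 0
  the same series give cos and sin, so one exponential formula serves horizontal and vertical
  generators. Dilation brings in the parameter only through s^2, as in s^2 q and s^2 z, which is why
  s = 0 is admissible. The sublaplacian of the group is the delicate operator: its outer field acts
  on a function that is itself known only away from the seam where the coordinate z jumps. The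
  horizontal group operators are therefore evaluated on functions that merely agree with a
  differentiable one near the point.\<close>

definition cosh_sqrt :: "real \<Rightarrow> real" where
  "cosh_sqrt q = (\<Sum>n. 1 / fact (2 * n) * q ^ n)"

definition sinhc_sqrt :: "real \<Rightarrow> real" where
  "sinhc_sqrt q = (\<Sum>n. 1 / fact (2 * n + 1) * q ^ n)"

definition sinhc_sqrt' :: "real \<Rightarrow> real" where
  "sinhc_sqrt' q = (\<Sum>n. diffs (\<lambda>n. 1 / fact (2 * n + 1)) n * q ^ n)"

text \<open>Domination by the exponential series, since \<open>fact (k n)\<close> is at least
  \<open>fact n\<close>.\<close>

lemma summable_over_fact:
  fixes q :: real
  assumes "\<And>n. n \<le> k n"
  shows "summable (\<lambda>n. 1 / fact (k n) * q ^ n)"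
proof (rule summable_comparison_test_ev)
  show "summable (\<lambda>n. \<bar>q\<bar> ^ n / fact n)"
    using summable_exp[of "\<bar>q\<bar>"] by (simp add: field_simps)
  have "(1 / fact (k n)) * \<bar>q\<bar> ^ n \<le> (1 / fact n) * \<bar>q\<bar> ^ n" for n
    by (intro mult_right_mono divide_left_mono fact_mono assms) auto
  then show "\<forall>\<^sub>F n in sequentially. norm (1 / fact (k n) * q ^ n) \<le> \<bar>q\<bar> ^ n / fact n"
    by (simp add: abs_mult power_abs)
qed

lemma cosh_sqrt_sums: "(\<lambda>n. 1 / fact (2 * n) * q ^ n) sums cosh_sqrt q"
  unfolding cosh_sqrt_def by (intro summable_sums summable_over_fact) auto

lemma sinhc_sqrt_sums: "(\<lambda>n. 1 / fact (2 * n + 1) * q ^ n) sums sinhc_sqrt q"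
  unfolding sinhc_sqrt_def by (intro summable_sums summable_over_fact) auto

lemma summable_diffs_sinhc_sqrt:
  "summable (\<lambda>n. diffs (\<lambda>n. 1 / fact (2 * n + 1)) n * (q::real) ^ n)"
  by (intro termdiff_converges_all summable_over_fact) auto

text \<open>The chain rule for cosh (sqrt q), obtained from the coefficients (n + 1) / (2n + 2)! =
  1/2 * 1 / (2n + 1)! so that q \<le> 0 is covered too.\<close>

lemma DERIV_cosh_sqrt:
  "(cosh_sqrt has_real_derivative sinhc_sqrt q / 2) (at q)"
proof -
  have "(cosh_sqrt has_real_derivative (\<Sum>n. diffs (\<lambda>n. 1 / fact (2 * n)) n * q ^ n)) (at q)"
    unfolding cosh_sqrt_def
    by (intro termdiffs_strong_converges_everywhere summable_over_fact) auto
  moreover have "diffs (\<lambda>n. 1 / fact (2 * n)) n = 1 / 2 * (1 / fact (2 * n + 1) :: real)" for n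
  proof -
    have "(2 + 2 * real n) / ((2 + 2 * real n) * fact (2 * n + 1)) = 1 / fact (2 * n + 1)"
      by (subst nonzero_divide_mult_cancel_left) auto
    then show ?thesis
      by (simp add: diffs_def field_simps del: fact_Suc) (simp add: algebra_simps)
  qed
  ultimately show ?thesis
    using sums_unique[OF sums_mult[OF sinhc_sqrt_sums[of q], of "1/2"]]
    by (simp add: mult.assoc)
qed

lemma DERIV_sinhc_sqrt:
  "(sinhc_sqrt has_real_derivative sinhc_sqrt' q) (at q)"
  unfolding sinhc_sqrt_def sinhc_sqrt'_def
  by (intro termdiffs_strong_converges_everywhere summable_over_fact) auto

text \<open>\<open>sinhc_sqrt'\<close> is itself a coefficient of the fields, and the sublaplacian
  differentiates these coefficients once more. Only continuity of that derivative matters, hence the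
  existential form.\<close>

lemma DERIV_sinhc_sqrt':
  "\<exists>d. (\<forall>q. (sinhc_sqrt' has_real_derivative d q) (at q)) \<and> continuous_on UNIV d"
proof (intro exI conjI allI)
  let ?a = "diffs (\<lambda>n. 1 / fact (2 * n + 1)) :: nat \<Rightarrow> real"
  let ?d = "\<lambda>q. \<Sum>n. diffs ?a n * q ^ n"
  show "(sinhc_sqrt' has_real_derivative ?d q) (at q)" for q
    unfolding sinhc_sqrt'_def
    by (intro termdiffs_strong_converges_everywhere summable_diffs_sinhc_sqrt)
  have "(?d has_real_derivative (\<Sum>n. diffs (diffs ?a) n * q ^ n)) (at q)" for q
    by (intro termdiffs_strong_converges_everywhere termdiff_converges_all
        summable_diffs_sinhc_sqrt)
  then show "continuous_on UNIV ?d"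
    by (meson DERIV_continuous continuous_at_imp_continuous_on)
qed

text \<open>For q = x^2 this is the derivative of sinh x = x * sinhc_sqrt (x^2); comparing
  coefficients gives it for all q. It is the identity behind the radial part of the fields.\<close>

lemma sinhc_sqrt'_eq: "sinhc_sqrt q + 2 * q * sinhc_sqrt' q = cosh_sqrt q"
proof -
  let ?c = "\<lambda>n. 1 / fact (2 * n + 1) :: real"
  have "(\<lambda>n. of_nat n * ?c n * q ^ (n - 1)) sums sinhc_sqrt' q"
    unfolding sinhc_sqrt'_def
    using diffs_equiv[OF summable_diffs_sinhc_sqrt] by simp
  then have "(\<lambda>n. ?c n * q ^ n + 2 * q * (of_nat n * ?c n * q ^ (n - 1)))
      sums (sinhc_sqrt q + 2 * q * sinhc_sqrt' q)"
    by (intro sums_add sums_mult sinhc_sqrt_sums)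
  moreover have "?c n * q ^ n + 2 * q * (of_nat n * ?c n * q ^ (n - 1)) = 1 / fact (2 * n) * q ^ n" for n
  proof -
    \<comment> \<open>At n = 0 the truncated exponent n - 1 is harmless, as the factor n
      vanishes.\<close>
    have "?c n * q ^ n + 2 * q * (of_nat n * ?c n * q ^ (n - 1)) = (2 * of_nat n + 1) * ?c n * q ^ n"
      by (cases n) (simp_all add: algebra_simps add_divide_distrib del: fact_Suc)
    also have "(2 * of_nat n + 1) * ?c n = 1 / fact (2 * n)"
      by (subst Suc_eq_plus1[symmetric], subst fact_Suc) (simp add: divide_simps)
    finally show ?thesis .
  qed
  ultimately have "(\<lambda>n. 1 / fact (2 * n) * q ^ n) sums (sinhc_sqrt q + 2 * q * sinhc_sqrt' q)"
    by (simp only:)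
  then show ?thesis
    using cosh_sqrt_sums sums_unique2 by blast
qed


lemma cosh_sqrt_square: "cosh_sqrt (x\<^sup>2) = cosh x"
proof -
  have "(\<lambda>n. x ^ (2 * n) /\<^sub>R fact (2 * n)) sums cosh x"
    using sums_mono_reindex[of "\<lambda>n. 2 * n" "\<lambda>n. if even n then x ^ n /\<^sub>R fact n else 0" "cosh x"]
      cosh_converges[of x] by (force simp: strict_mono_def image_iff elim!: evenE)
  moreover have "x ^ (2 * n) /\<^sub>R fact (2 * n) = 1 / fact (2 * n) * (x\<^sup>2) ^ n" for n
    by (simp only: power_mult real_scaleR_def divide_inverse mult_1_left)
  ultimately have "(\<lambda>n. 1 / fact (2 * n) * (x\<^sup>2) ^ n) sums cosh x"
    by (simp only:)
  then show ?thesis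
    using cosh_sqrt_sums sums_unique2 by blast
qed

lemma sinhc_sqrt_square: "x * sinhc_sqrt (x\<^sup>2) = sinh x"
proof -
  have "(\<lambda>n. x ^ (2 * n + 1) /\<^sub>R fact (2 * n + 1)) sums sinh x"
    using sums_mono_reindex[of "\<lambda>n. 2 * n + 1" "\<lambda>n. if even n then 0 else x ^ n /\<^sub>R fact n" "sinh x"]
      sinh_converges[of x] by (force simp: strict_mono_def image_iff elim!: oddE)
  moreover have "x ^ (2 * n + 1) /\<^sub>R fact (2 * n + 1) = x * (1 / fact (2 * n + 1) * (x\<^sup>2) ^ n)" for n
    by (simp only: power_add power_one_right power_mult[symmetric] real_scaleR_def divide_inverse mult_1_left mult_ac)
  ultimately have "(\<lambda>n. x * (1 / fact (2 * n + 1) * (x\<^sup>2) ^ n)) sums sinh x"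
    by (simp only:)
  then show ?thesis
    using sums_mult[OF sinhc_sqrt_sums] sums_unique2 by blast
qed

lemma cosh_sqrt_minus_square: "cosh_sqrt (- (x\<^sup>2)) = cos x"
proof -
  have "(- (x\<^sup>2)) ^ n = (- 1) ^ n * x ^ (2 * n)" for n
    by (subst power_minus) (simp add: power_mult)
  then have "1 / fact (2 * n) * (- (x\<^sup>2)) ^ n = (- 1) ^ n / fact (2 * n) * x ^ (2 * n)" for n
    by (simp only: times_divide_eq_left mult_1_left)
  then have "(\<lambda>n. 1 / fact (2 * n) * (- (x\<^sup>2)) ^ n) sums cos x"
    using cos_paired[of x] by (simp only:)
  then show ?thesis
    using cosh_sqrt_sums sums_unique2 by blast
qed

lemma sinhc_sqrt_minus_square: "x * sinhc_sqrt (- (x\<^sup>2)) = sin x"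
proof -
  have "(- (x\<^sup>2)) ^ n = (- 1) ^ n * x ^ (2 * n)" for n
    by (subst power_minus) (simp add: power_mult)
  then have "x * (1 / fact (2 * n + 1) * (- (x\<^sup>2)) ^ n)
      = (- 1) ^ n / fact (2 * n + 1) * x ^ (2 * n + 1)" for n
    by (simp only: times_divide_eq_left mult_1_left times_divide_eq_right power_add power_one_right mult_ac)
  then have "(\<lambda>n. x * (1 / fact (2 * n + 1) * (- (x\<^sup>2)) ^ n)) sums sin x"
    using sin_paired[of x] by (simp only:)
  then show ?thesis
    using sums_mult[OF sinhc_sqrt_sums] sums_unique2 by blast
qed

lemma cosh_sqrt_0: "cosh_sqrt 0 = 1"
  unfolding cosh_sqrt_def by (subst powser_zero) simp

lemma sinhc_sqrt_0: "sinhc_sqrt 0 = 1"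
  unfolding sinhc_sqrt_def by (subst powser_zero) simp

lemma cosh_sqrt_pos: "q \<ge> 0 \<Longrightarrow> cosh_sqrt q > 0"
  using cosh_sqrt_square[of "sqrt q"] by simp

lemma sinhc_sqrt_pos:
  assumes "q \<ge> 0"
  shows "sinhc_sqrt q > 0"
proof (cases "q = 0")
  case True
  then show ?thesis
    by (simp add: sinhc_sqrt_0)
next
  case False
  then show ?thesis
    using sinhc_sqrt_square[of "sqrt q"] assms
    by (smt (verit) real_sqrt_gt_zero real_sqrt_pow2 sinh_real_pos_iff zero_less_mult_pos)
qed

lemma cosh_sqrt_sinhc_sqrt: "q \<ge> 0 \<Longrightarrow> (cosh_sqrt q)\<^sup>2 - q * (sinhc_sqrt q)\<^sup>2 = 1"
  using cosh_sqrt_square[of "sqrt q"] sinhc_sqrt_square[of "sqrt q"] hyperbolic_pythagoras[of "sqrt q"]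
  by (metis power_mult_distrib real_sqrt_pow2)

subsection \<open>Matrices\<close>

lemma mat2_eq_iff:
  "(A::mat2) = B \<longleftrightarrow>
     A $ 1 $ 1 = B $ 1 $ 1 \<and> A $ 1 $ 2 = B $ 1 $ 2 \<and> A $ 2 $ 1 = B $ 2 $ 1 \<and> A $ 2 $ 2 = B $ 2 $ 2"
  by (auto simp: vec_eq_iff forall_2)

text \<open>Even powers of A are q^k and odd ones q^k A, so the exponential series splits into the
  two series above. By Cayley-Hamilton every traceless A qualifies, with q = - det A.\<close>

lemma mexp_square_scalar:
  fixes A :: mat2
  assumes "A ** A = q *\<^sub>R mat 1"
  shows "mexp A = cosh_sqrt q *\<^sub>R mat 1 + sinhc_sqrt q *\<^sub>R A"
proof -
  let ?p = "\<lambda>k. (((**) A ^^ k) (mat 1))"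
  have even: "?p (2 * k) = q ^ k *\<^sub>R mat 1" for k
    by (induction k) (simp_all add: assms matrix_mul_assoc matrix_scalar_ac scalar_matrix_assoc[symmetric])
  then have odd: "?p (2 * k + 1) = q ^ k *\<^sub>R A" for k
    by (simp add: matrix_scalar_ac)
  let ?e = "\<lambda>k. if even k then (1 / fact k) *\<^sub>R ?p k else 0"
  let ?o = "\<lambda>k. if even k then 0 else (1 / fact k) *\<^sub>R ?p k"
  have "(\<lambda>k. ?e (2 * k)) sums (cosh_sqrt q *\<^sub>R mat 1)"
    using sums_scaleR_left[OF cosh_sqrt_sums[of q]] by (simp add: even)
  then have "?e sums (cosh_sqrt q *\<^sub>R mat 1)"
    by (subst (asm) sums_mono_reindex) (auto simp: strict_mono_def elim!: evenE)
  moreover have "(\<lambda>k. ?o (2 * k + 1)) sums (sinhc_sqrt q *\<^sub>R A)"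
    using sums_scaleR_left[OF sinhc_sqrt_sums[of q]] odd by (simp del: fact_Suc funpow.simps)
  then have "?o sums (sinhc_sqrt q *\<^sub>R A)"
    by (subst (asm) sums_mono_reindex) (auto simp: strict_mono_def elim!: oddE)
  ultimately have "(\<lambda>k. ?e k + ?o k) sums (cosh_sqrt q *\<^sub>R mat 1 + sinhc_sqrt q *\<^sub>R A)"
    by (rule sums_add)
  moreover have "?e k + ?o k = (1 / fact k) *\<^sub>R ?p k" for k
    by simp
  ultimately show ?thesis
    unfolding mexp_def by (metis (no_types, lifting) ext sums_unique)
qed

text \<open>The pair \<open>(u, w)\<close> stands for the matrix \<open>u + X w\<close>, where \<open>\<complex>\<close> is embedded as \<open>\<real>[Z]\<close>; the product
  follows from \<open>Z X = - X Z\<close> and \<open>X\<^sup>2 = 1\<close>.\<close>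

definition pair_mat :: "complex \<times> complex \<Rightarrow> mat2" where
  "pair_mat = (\<lambda>(u, w). Re u *\<^sub>R mat 1 + Im u *\<^sub>R matZ + Re w *\<^sub>R matX + Im w *\<^sub>R matY)"

definition pair_mult :: "complex \<times> complex \<Rightarrow> complex \<times> complex \<Rightarrow> complex \<times> complex" where
  "pair_mult = (\<lambda>(u, w) (u', w'). (u * u' + cnj w * w', cnj u * w' + w * u'))"

lemma pair_mat_entries:
  "pair_mat (u, w) $ 1 $ 1 = Re u + Re w" "pair_mat (u, w) $ 1 $ 2 = Im u + Im w"
  "pair_mat (u, w) $ 2 $ 1 = Im w - Im u" "pair_mat (u, w) $ 2 $ 2 = Re u - Re w"
  by (simp_all add: pair_mat_def matX_def matY_def matZ_def mat_def)

lemma pair_mat_mult: "pair_mat P ** pair_mat Q = pair_mat (pair_mult P Q)"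
  by (cases P; cases Q) (simp add: mat2_eq_iff matrix_matrix_mult_def sum_2 pair_mat_entries
    pair_mult_def algebra_simps)

lemma inj_pair_mat: "pair_mat P = pair_mat Q \<longleftrightarrow> P = Q"
  by (cases P; cases Q) (auto simp: mat2_eq_iff pair_mat_entries complex_eq_iff)

lemma bounded_linear_pair_mat: "bounded_linear pair_mat"
  unfolding pair_mat_def case_prod_unfold
  by (intro bounded_linear_add bounded_linear_scaleR_left[THEN bounded_linear_compose]
      bounded_linear_compose[OF bounded_linear_Re] bounded_linear_compose[OF bounded_linear_Im]
      bounded_linear_fst bounded_linear_snd)

lemma mat_eq_pair_mat:
  "mat 1 = pair_mat (1, 0)" "matZ = pair_mat (\<i>, 0)" "matX = pair_mat (0, 1)" "matY = pair_mat (0, \<i>)"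
  by (simp_all add: pair_mat_def)

lemma pair_mat_scaleR: "r *\<^sub>R pair_mat P = pair_mat (r *\<^sub>R P)"
  using bounded_linear_pair_mat by (simp add: linear_simps)

lemma pair_mat_add: "pair_mat P + pair_mat Q = pair_mat (P + Q)"
  using bounded_linear_pair_mat by (simp add: linear_simps)

lemma mexp_pair_mat:
  assumes "pair_mult P P = (complex_of_real q, 0)"
  shows "mexp (pair_mat P) = pair_mat (cosh_sqrt q *\<^sub>R (1, 0) + sinhc_sqrt q *\<^sub>R P)"
  by (subst mexp_square_scalar[of _ q])
    (simp_all only: pair_mat_mult assms mat_eq_pair_mat pair_mat_scaleR pair_mat_add,
      simp_all add: scaleR_conv_of_real)

text \<open>Here the square is the nonnegative scalar (cmod v)^2, the hyperbolic case; for the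
  vertical generator it is - z^2, and the same formula becomes a rotation.\<close>

lemma mexp_horizontal:
  fixes v :: complex
  shows "mexp (pair_mat (0, v)) = pair_mat (of_real (cosh_sqrt ((cmod v)\<^sup>2)), sinhc_sqrt ((cmod v)\<^sup>2) * v)"
  by (subst mexp_pair_mat[where q = "(cmod v)\<^sup>2"])
    (simp_all add: pair_mult_def complex_norm_square[symmetric] mult.commute scaleR_conv_of_real)

lemma mexp_vertical: "mexp (z *\<^sub>R matZ) = pair_mat (cis z, 0)"
  using cosh_sqrt_minus_square[of z] sinhc_sqrt_minus_square[of z]
  unfolding mat_eq_pair_mat pair_mat_scaleR
  by (subst mexp_pair_mat[where q = "- (z\<^sup>2)"])
    (auto simp: pair_mult_def complex_eq_iff power2_eq_square inj_pair_mat mult.commute)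

subsection \<open>The exponential coordinates\<close>

text \<open>A polar decomposition: the positive symmetric factor (C, S v) times the rotation (cis z,
  0), with C, S the two series at x^2 + y^2. Hence z is an argument of the first component.\<close>

definition sl2_pair :: "heis \<Rightarrow> complex \<times> complex" where
  "sl2_pair = (\<lambda>(x, y, z). (cosh_sqrt (x\<^sup>2 + y\<^sup>2) *\<^sub>R cis z,
                            sinhc_sqrt (x\<^sup>2 + y\<^sup>2) *\<^sub>R (Complex x y * cis z)))"

lemma sl2_map_eq: "sl2_map p = pair_mat (sl2_pair p)"
proof -
  obtain x y z where p: "p = (x, y, z)"
    by (cases p)
  have "x *\<^sub>R matX + y *\<^sub>R matY = pair_mat (0, Complex x y)"
    by (simp add: pair_mat_def)
  then show ?thesis
    by (simp add: p sl2_map_def sl2_pair_def mexp_horizontal mexp_vertical pair_mat_mult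
        pair_mult_def cmod_power2 flip: scaleR_conv_of_real)
qed

text \<open>The local \<open>r\<close> is half the differential of q, not the radius.\<close>

definition sl2_pair_deriv :: "heis \<Rightarrow> heis \<Rightarrow> complex \<times> complex" where
  "sl2_pair_deriv = (\<lambda>(x, y, z) (h, k, l).
     let q = x\<^sup>2 + y\<^sup>2; r = x * h + y * k; v = Complex x y
     in ((sinhc_sqrt q * r + \<i> * (l * cosh_sqrt q)) * cis z,
         (2 * sinhc_sqrt' q * r * v + sinhc_sqrt q * Complex h k + \<i> * (l * sinhc_sqrt q) * v) * cis z))"

lemma has_derivative_real_compose:
  assumes "(g has_real_derivative d) (at (f x))" and "(f has_derivative f') (at x)"
  shows "((\<lambda>x. g (f x)) has_derivative (\<lambda>h. d * f' h)) (at x)"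
  using has_derivative_compose[OF assms(2)] assms(1) by (simp add: has_field_derivative_def)

lemma has_derivative_sl2_pair: "(sl2_pair has_derivative sl2_pair_deriv p) (at p)"
proof -
  obtain x y z where p: "p = (x, y, z)"
    by (cases p)
  have q: "((\<lambda>p::heis. (fst p)\<^sup>2 + (fst (snd p))\<^sup>2) has_derivative
     (\<lambda>h. 2 * (x * fst h + y * fst (snd h)))) (at p)"
    by (auto intro!: derivative_eq_intros simp: p)
  have "((\<lambda>p::heis. of_real (fst p) + \<i> * of_real (fst (snd p))) has_derivative
     (\<lambda>h. of_real (fst h) + \<i> * of_real (fst (snd h)))) (at p)"
    by (intro derivative_intros)
  then have v: "((\<lambda>p::heis. Complex (fst p) (fst (snd p))) has_derivative
     (\<lambda>h. Complex (fst h) (fst (snd h)))) (at p)"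
    by (simp add: Complex_eq)
  have "((\<lambda>p::heis. snd (snd p)) has_derivative (\<lambda>h. snd (snd h))) (at p)"
    by (intro derivative_intros)
  note c = has_derivative_cis[OF this]
  note C = has_derivative_real_compose[OF DERIV_cosh_sqrt q]
  note S = has_derivative_real_compose[OF DERIV_sinhc_sqrt q]
  show ?thesis
    unfolding sl2_pair_def case_prod_unfold
    by (rule has_derivative_eq_rhs[OF has_derivative_Pair[OF has_derivative_scaleR[OF C c]
          has_derivative_scaleR[OF S has_derivative_mult[OF v c]]]])
      (auto simp: p fun_eq_iff sl2_pair_deriv_def Let_def scaleR_conv_of_real algebra_simps)
qed

lemma has_derivative_sl2_map: "(sl2_map has_derivative (\<lambda>h. pair_mat (sl2_pair_deriv p h))) (at p)"
proof -
  have "sl2_map = (\<lambda>p. pair_mat (sl2_pair p))"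
    by (simp add: sl2_map_eq fun_eq_iff)
  then show ?thesis
    using bounded_linear.has_derivative[OF bounded_linear_pair_mat has_derivative_sl2_pair] by simp
qed

text \<open>As both series are positive, the first component of a kernel vector forces r = 0 and l =
  0, and the second then forces the horizontal part to vanish. This gives uniqueness for the
  \<open>THE\<close> in \<open>cover_field\<close>.\<close>

lemma inj_sl2_pair_deriv: "inj (sl2_pair_deriv p)"
proof -
  have "linear (sl2_pair_deriv p)"
    using has_derivative_sl2_pair has_derivative_linear by blast
  moreover have "h = 0" if "sl2_pair_deriv p h = 0" for h
  proof -
    obtain x y z h1 h2 l where p: "p = (x, y, z)" and h: "h = (h1, h2, l)"
      by (cases p, cases h)
    define q where "q = x\<^sup>2 + y\<^sup>2"
    have pos: "cosh_sqrt q > 0" "sinhc_sqrt q > 0"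
      by (auto simp: q_def intro!: cosh_sqrt_pos sinhc_sqrt_pos)
    have "complex_of_real (sinhc_sqrt q) * (x * h1 + y * h2) + \<i> * (l * cosh_sqrt q) = 0"
      using that by (simp add: p h sl2_pair_deriv_def Let_def q_def zero_prod_def)
    then have 1: "x * h1 + y * h2 = 0" "l = 0"
      using pos by (auto simp: complex_eq_iff)
    have "2 * sinhc_sqrt' q * (x * h1 + y * h2) * Complex x y + sinhc_sqrt q * Complex h1 h2
        + \<i> * (l * sinhc_sqrt q) * Complex x y = 0"
      using that by (simp add: p h sl2_pair_deriv_def Let_def q_def zero_prod_def)
    then have "sinhc_sqrt q * Complex h1 h2 = 0"
      using 1 by (simp flip: of_real_mult of_real_add)
    then show ?thesis
      using 1 pos by (auto simp: h complex_eq_iff zero_prod_def)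
  qed
  ultimately show ?thesis
    by (simp add: linear_injective_0)
qed

text \<open>At \<open>s = 1\<close> this is the field generated by \<open>Re a X + Im a Y\<close>, i.e. the solution of
  \<open>sl2_pair_deriv p v = pair_mult (sl2_pair p) (0, a)\<close>; the parameter \<open>s = 1 / sqrt c\<close> is the dilation. The
  function \<open>sinhc_sqrt' / sinhc_sqrt\<close> of \<open>r\<^sup>2\<close> absorbs the apparent singularity at \<open>r = 0\<close>.\<close>

definition horizontal_field :: "complex \<Rightarrow> real \<Rightarrow> heis \<Rightarrow> heis" where
  "horizontal_field a s = (\<lambda>(x, y, z).
     let q = s\<^sup>2 * (x\<^sup>2 + y\<^sup>2); v = Complex x y; b = a * cis (- (2 * s\<^sup>2 * z));
         m = cnj v * b; k = sinhc_sqrt q / cosh_sqrt q;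
         w = (cosh_sqrt q / sinhc_sqrt q) *\<^sub>R b
             - (2 * s\<^sup>2 * (sinhc_sqrt' q / sinhc_sqrt q) * Re m) *\<^sub>R v - (s\<^sup>2 * k * Im m) *\<^sub>R (\<i> * v)
     in (Re w, Im w, k * Im m))"

text \<open>Dividing by cis z leaves, with b = a cis (-2z) and m = cnj v * b, the equations S r + i
  l C = S m and 2 T r v + S w + i l S v = C b. The first gives r = Re m and l = (S / C) Im m, the
  second then gives w. What remains is consistency: the radial part Re (cnj v * w) must be Re
  m.\<close>

lemma sl2_pair_deriv_horizontal_field:
  "sl2_pair_deriv p (horizontal_field a 1 p) = pair_mult (sl2_pair p) (0, a)"
proof -
  obtain x y z where p: "p = (x, y, z)"
    by (cases p)
  define q where "q = x\<^sup>2 + y\<^sup>2"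
  define C where "C = cosh_sqrt q"
  define S where "S = sinhc_sqrt q"
  define T where "T = sinhc_sqrt' q"
  define v where "v = Complex x y"
  define b where "b = a * cis (- (2 * z))"
  define m where "m = cnj v * b"
  define w where "w = (C / S) *\<^sub>R b - (2 * (T / S) * Re m) *\<^sub>R v - (S / C * Im m) *\<^sub>R (\<i> * v)"
  have C: "C \<noteq> 0" and S: "S \<noteq> 0"
    unfolding C_def S_def q_def
    by (metis cosh_sqrt_pos sinhc_sqrt_pos less_irrefl sum_power2_ge_zero)+
  have rel: "C = S + 2 * q * T"
    unfolding C_def S_def T_def by (simp add: sinhc_sqrt'_eq)
  have W: "horizontal_field a 1 p = (Re w, Im w, S / C * Im m)"
    by (simp add: p horizontal_field_def Let_def w_def m_def b_def v_def C_def S_def T_def q_def)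
  have m: "Re m = x * Re b + y * Im b"
    by (simp add: m_def v_def)
  \<comment> \<open>The term along i v drops out, being orthogonal to v; \<open>rel\<close> then
    closes the consistency check.\<close>
  have "x * Re w + y * Im w = (C / S) * Re m - (2 * (T / S) * Re m) * q"
    unfolding w_def by (simp add: v_def q_def power2_eq_square algebra_simps) (simp add: m algebra_simps add_divide_distrib)
  also have "\<dots> = Re m"
    using S by (simp add: rel field_simps)
  finally have r: "x * Re w + y * Im w = Re m" .
  have b: "b * cis z = a * cis (- z)"
    by (simp add: b_def mult.assoc cis_mult)
  have "sinhc_sqrt q * complex_of_real (Re m) + \<i> * (S / C * Im m * cosh_sqrt q) = S * (cnj v * b)"
    using C unfolding m_def[symmetric] C_def[symmetric] S_def[symmetric]
    by (simp add: complex_eq_iff)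
  then have 1: "(sinhc_sqrt q * complex_of_real (Re m) + \<i> * (S / C * Im m * cosh_sqrt q)) * cis z
      = S * cnj v * cis (- z) * a"
    using b by (simp add: mult_ac)
  have "2 * sinhc_sqrt' q * Re m * v + sinhc_sqrt q * w + \<i> * (S / C * Im m * sinhc_sqrt q) * v = C * b"
    unfolding w_def C_def[symmetric] S_def[symmetric] T_def[symmetric]
    using S C by (simp add: scaleR_conv_of_real field_simps)
  then have 2: "(2 * sinhc_sqrt' q * Re m * v + sinhc_sqrt q * w + \<i> * (S / C * Im m * sinhc_sqrt q) * v)
      * cis z = C * cis (- z) * a"
    using b by (simp add: mult_ac)
  have pair: "sl2_pair p = (C *\<^sub>R cis z, S *\<^sub>R (v * cis z))"
    by (simp add: p sl2_pair_def C_def S_def q_def v_def)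
  have deriv: "sl2_pair_deriv p (Re w, Im w, S / C * Im m) =
     ((sinhc_sqrt q * complex_of_real (Re m) + \<i> * (S / C * Im m * cosh_sqrt q)) * cis z,
      (2 * sinhc_sqrt' q * Re m * v + sinhc_sqrt q * w + \<i> * (S / C * Im m * sinhc_sqrt q) * v) * cis z)"
    unfolding p sl2_pair_deriv_def Let_def prod.case r by (simp add: q_def v_def)
  show ?thesis
    unfolding W deriv 1 2
    by (simp add: pair pair_mult_def scaleR_conv_of_real cis_cnj)
qed

lemma cover_field_eqI:
  assumes "sl2_pair_deriv p v = pair_mult (sl2_pair p) A"
  shows "cover_field (pair_mat A) p = v"
proof -
  have D: "frechet_derivative sl2_map (at p) = (\<lambda>h. pair_mat (sl2_pair_deriv p h))"
    using frechet_derivative_at[OF has_derivative_sl2_map] by simp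
  show ?thesis
    unfolding cover_field_def D sl2_map_eq pair_mat_mult inj_pair_mat assms[symmetric]
    using inj_sl2_pair_deriv[of p] by (intro the_equality) (auto dest: injD)
qed

lemma cover_field_horizontal: "cover_field (pair_mat (0, a)) p = horizontal_field a 1 p"
  by (intro cover_field_eqI sl2_pair_deriv_horizontal_field)

lemma cover_field_vertical: "cover_field (pair_mat (\<i>, 0)) p = (0, 0, 1)"
  by (rule cover_field_eqI)
    (simp add: sl2_pair_deriv_def sl2_pair_def pair_mult_def Let_def scaleR_conv_of_real
      mult_ac case_prod_unfold flip: zero_complex.code)

subsection \<open>Inverting the coordinate map\<close>

text \<open>At \<open>v = 0\<close> the quotient is the junk value \<open>0 / 0 = 0\<close>, which is harmless since it multiplies \<open>v\<close>.\<close>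

definition log_coord :: "complex \<times> complex \<Rightarrow> heis" where
  "log_coord = (\<lambda>(u, w). let v = w * cis (- Arg u); v' = (arsinh (cmod v) / cmod v) *\<^sub>R v
     in (Re v', Im v', Arg u))"

text \<open>The determinant of \<open>pair_mat (u, w)\<close>, so the value 1 singles out the
  group.\<close>

definition pair_det :: "complex \<times> complex \<Rightarrow> real" where
  "pair_det = (\<lambda>(u, w). (cmod u)\<^sup>2 - (cmod w)\<^sup>2)"

lemma pair_det_mult: "pair_det (pair_mult P Q) = pair_det P * pair_det Q"
proof -
  have "complex_of_real (pair_det (pair_mult P Q)) = complex_of_real (pair_det P * pair_det Q)"
    by (simp add: pair_det_def pair_mult_def case_prod_unfold complex_norm_square algebra_simps
        del: of_real_power)
  then show ?thesis
    using of_real_eq_iff by blast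
qed

lemma pair_det_sl2_pair: "pair_det (sl2_pair p) = 1"
proof -
  obtain x y z where p: "p = (x, y, z)"
    by (cases p)
  show ?thesis
    using cosh_sqrt_sinhc_sqrt[of "x\<^sup>2 + y\<^sup>2"]
    unfolding p pair_det_def sl2_pair_def prod.case norm_scaleR norm_mult power_mult_distrib
    by (simp add: cmod_power2[of "Complex x y"] mult.commute)
qed

text \<open>The bounds on z and the positive factor in front of cis z make \<open>Arg\<close> return
  z itself. Once the rotation is removed, the remaining vector has length sinh (cmod v), which
  arsinh undoes.\<close>

lemma log_coord_sl2_pair:
  assumes "- pi < snd (snd p)" "snd (snd p) \<le> pi"
  shows "log_coord (sl2_pair p) = p"
proof -
  obtain x y z where p: "p = (x, y, z)"
    by (cases p)
  define q where "q = x\<^sup>2 + y\<^sup>2"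
  define v where "v = Complex x y"
  have q: "q = (cmod v)\<^sup>2"
    by (simp add: q_def v_def cmod_power2)
  have C: "cosh_sqrt q > 0" and S: "sinhc_sqrt q > 0"
    by (simp_all add: q_def cosh_sqrt_pos sinhc_sqrt_pos)
  have Arg: "Arg (cosh_sqrt q *\<^sub>R cis z) = z"
    using assms C by (intro Arg_unique) (auto simp: p scaleR_conv_of_real cis_conv_exp)
  have w: "(sinhc_sqrt q *\<^sub>R (v * cis z)) * cis (- z) = sinhc_sqrt q *\<^sub>R v"
    by (simp add: mult.assoc cis_mult)
  have n: "cmod (sinhc_sqrt q *\<^sub>R v) = sinh (cmod v)"
    using S sinhc_sqrt_square[of "cmod v"] by (simp add: q mult.commute)
  have "(arsinh (sinh (cmod v)) / sinh (cmod v)) *\<^sub>R (sinhc_sqrt q *\<^sub>R v) = v"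
  proof (cases "v = 0")
    case False
    then show ?thesis
      using S sinhc_sqrt_square[of "cmod v"]
      by (simp add: arsinh_sinh_real q[symmetric])
  qed simp
  then show ?thesis
    by (simp only: p sl2_pair_def log_coord_def Let_def prod.case Arg w n q_def[symmetric] v_def[symmetric])
      (simp only: v_def complex.sel)
qed

text \<open>With sinh r = cmod v the determinant condition reads (cmod u)^2 = (cosh r)^2, so the
  modulus of u carries no information beyond r.\<close>

lemma sl2_pair_log_coord:
  assumes "pair_det P = 1"
  shows "sl2_pair (log_coord P) = P"
proof -
  obtain u w where P: "P = (u, w)"
    by (cases P)
  define v where "v = w * cis (- Arg u)"
  define r where "r = arsinh (cmod v)"
  define v' where "v' = (r / cmod v) *\<^sub>R v"
  have det: "(cmod u)\<^sup>2 = 1 + (cmod v)\<^sup>2"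
    using assms by (simp add: P pair_det_def v_def norm_mult)
  have r: "sinh r = cmod v"
    by (simp add: r_def)
  then have "r \<ge> 0"
    by (metis norm_ge_zero sinh_real_nonneg_iff)
  have "cmod v' = r"
    using r \<open>r \<ge> 0\<close> by (cases "v = 0") (auto simp: v'_def)
  then have q: "(Re v')\<^sup>2 + (Im v')\<^sup>2 = r\<^sup>2"
    by (metis cmod_power2)
  have "(cosh r)\<^sup>2 = (cmod u)\<^sup>2"
    using det r by (simp add: cosh_square_eq)
  then have "cosh r = cmod u"
    by (metis cosh_real_nonneg norm_ge_zero power2_eq_imp_eq)
  then have "cosh_sqrt (r\<^sup>2) *\<^sub>R cis (Arg u) = u"
    using rcis_cmod_Arg[of u] by (simp add: cosh_sqrt_square rcis_def scaleR_conv_of_real)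
  moreover have "sinhc_sqrt (r\<^sup>2) *\<^sub>R v' = v"
  proof (cases "v = 0")
    case False
    then show ?thesis
      using r sinhc_sqrt_square[of r] by (simp add: v'_def mult.commute)
  qed (simp add: v'_def)
  then have "sinhc_sqrt (r\<^sup>2) *\<^sub>R (v' * cis (Arg u)) = w"
    unfolding scaleR_scaleR mult_scaleR_left[symmetric] by (simp add: v_def mult.assoc cis_mult)
  moreover have "log_coord P = (Re v', Im v', Arg u)"
    by (simp only: P log_coord_def Let_def prod.case v_def v'_def r_def)
  ultimately show ?thesis
    by (simp only: P sl2_pair_def prod.case q complex.collapse)
qed

text \<open>\<open>Arg\<close> takes values in (-pi, pi], so a matrix of determinant 1 has exactly
  one coordinate triple in that strip, and the \<open>THE\<close> is well defined.\<close>

lemma sl2_coord_eq: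
  assumes "pair_det P = 1"
  shows "sl2_coord (pair_mat P) = log_coord P"
  unfolding sl2_coord_def sl2_map_eq inj_pair_mat
proof (rule the_equality)
  show "sl2_pair (log_coord P) = P \<and> - pi < snd (snd (log_coord P)) \<and> snd (snd (log_coord P)) \<le> pi"
    using sl2_pair_log_coord[OF assms] mpi_less_Arg Arg_le_pi
    by (simp add: log_coord_def Let_def case_prod_unfold)
  show "p = log_coord P" if "sl2_pair p = P \<and> - pi < snd (snd p) \<and> snd (snd p) \<le> pi" for p
    using that log_coord_sl2_pair by metis
qed

text \<open>At 0 the norm of the map is arsinh (cmod v), which tends to 0.\<close>

lemma isCont_radial_arsinh:
  "isCont (\<lambda>v::complex. (arsinh (cmod v) / cmod v) *\<^sub>R v) v"
proof (cases "v = 0")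
  case True
  have "((\<lambda>v::complex. arsinh (cmod v)) \<longlongrightarrow> 0) (at 0)"
    by (auto intro!: tendsto_eq_intros)
  then have "((\<lambda>v::complex. (arsinh (cmod v) / cmod v) *\<^sub>R v) \<longlongrightarrow> 0) (at 0)"
    by (rule tendsto_norm_zero[THEN Lim_null_comparison[rotated]]) (auto simp: eventually_at_filter)
  then show ?thesis
    by (simp add: True isCont_def)
next
  case False
  then show ?thesis
    by (intro continuous_intros) auto
qed

text \<open>The excluded ray is the branch cut of \<open>Arg\<close>: the seam z = pi of the
  periodic coordinate.\<close>

lemma isCont_log_coord:
  assumes "fst P \<notin> \<real>\<^sub>\<le>\<^sub>0"
  shows "isCont log_coord P"
proof -
  have Arg: "isCont (\<lambda>P::complex \<times> complex. Arg (fst P)) P"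
    using continuous_at_Arg[OF assms] by (rule isCont_o2[rotated]) (auto intro: continuous_intros)
  then have v: "isCont (\<lambda>P. snd P * cis (- Arg (fst P))) P"
    unfolding cis_conv_exp by (intro continuous_intros)
  note c = isCont_o2[OF v isCont_radial_arsinh]
  have "isCont (\<lambda>P. let v = snd P * cis (- Arg (fst P)); v' = (arsinh (cmod v) / cmod v) *\<^sub>R v
     in (Re v', Im v', Arg (fst P))) P"
    unfolding Let_def by (intro continuous_intros bounded_linear.isCont[OF bounded_linear_Re c]
      bounded_linear.isCont[OF bounded_linear_Im c] Arg)
  then show ?thesis
    by (simp add: log_coord_def case_prod_unfold Let_def)
qed

text \<open>An injective f' satisfies norm h \<le> m * norm (f' h), so the error of g is controlled
  by the errors of f and of the composition. Consequently continuity of \<open>log_coord\<close> is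
  enough, and the derivatives of \<open>Arg\<close> and of the radial arsinh never have to be
  computed.\<close>

lemma has_derivative_lift_immersion:
  fixes f :: "'b::euclidean_space \<Rightarrow> 'c::euclidean_space" and g :: "'a::real_normed_vector \<Rightarrow> 'b"
  assumes f: "(f has_derivative f') (at (g x))" and inj: "inj f'"
    and fg: "((\<lambda>y. f (g y)) has_derivative (\<lambda>h. f' (g' h))) (at x)"
    and g: "isCont g x" and g': "bounded_linear g'"
  shows "(g has_derivative g') (at x)"
proof -
  have lin: "linear f'"
    using f has_derivative_linear by blast
  obtain m where m: "m > 0" "\<And>h. norm h \<le> m * norm (f' h)"
  proof -
    obtain L where "linear L" "L \<circ> f' = id"
      using linear_injective_left_inverse[OF lin inj] by auto
    moreover obtain B where "B > 0" "\<And>h. norm (L h) \<le> norm h * B"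
      using \<open>linear L\<close> linear_conv_bounded_linear bounded_linear.pos_bounded by blast
    ultimately show ?thesis
      by (intro that[of B]) (auto simp: fun_eq_iff mult.commute, metis)
  qed
  obtain K where K: "K > 0" "\<And>h. norm (g' h) \<le> norm h * K"
    using g' bounded_linear.pos_bounded by blast
  show ?thesis
    unfolding has_derivative_at_alt
  proof (intro conjI g' allI impI)
    fix e :: real assume e: "e > 0"
    \<comment> \<open>The first bound gives m d \<le> 1/2, so half of norm R can be absorbed on the
      left; the second leaves e/2 for the other terms, which the absorption doubles to e.\<close>
    define d where "d = min (1 / (2 * m)) (e / (2 * m * (K + 1)))"
    have d: "d > 0"
      using e m K by (simp add: d_def)
    have "d \<le> 1 / (2 * m)" "d \<le> e / (2 * m * (K + 1))"
      by (simp_all add: d_def)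
    then have dm: "m * d \<le> 1 / 2" and de: "m * d * (K + 1) \<le> e / 2"
      using m(1) K(1) by (simp_all add: pos_le_divide_eq mult_ac)
    obtain \<delta>1 where \<delta>1: "\<delta>1 > 0"
      "\<And>y. norm (y - g x) < \<delta>1 \<Longrightarrow> norm (f y - f (g x) - f' (y - g x)) \<le> d * norm (y - g x)"
      using f d unfolding has_derivative_at_alt by blast
    obtain \<delta>2 where \<delta>2: "\<delta>2 > 0"
      "\<And>y. norm (y - x) < \<delta>2 \<Longrightarrow> norm (f (g y) - f (g x) - f' (g' (y - x))) \<le> d * norm (y - x)"
      using fg d unfolding has_derivative_at_alt by blast
    obtain \<delta>3 where \<delta>3: "\<delta>3 > 0" "\<And>y. norm (y - x) < \<delta>3 \<Longrightarrow> norm (g y - g x) < \<delta>1"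
      using g \<delta>1(1) unfolding continuous_at_eps_delta dist_norm by blast
    have "norm (g y - g x - g' (y - x)) \<le> e * norm (y - x)" if y: "norm (y - x) < min \<delta>2 \<delta>3" for y
    proof -
      define R where "R = g y - g x - g' (y - x)"
      have "f' R = f' (g y - g x) - f' (g' (y - x))"
        unfolding R_def using lin by (simp add: linear_diff)
      also have "\<dots> = (f (g y) - f (g x) - f' (g' (y - x))) - (f (g y) - f (g x) - f' (g y - g x))"
        by simp
      also have "norm \<dots> \<le> d * norm (y - x) + d * norm (g y - g x)"
        by (rule order_trans[OF norm_triangle_ineq4]) (use y \<delta>1 \<delta>2 \<delta>3 in \<open>intro add_mono; simp\<close>)
      also have "norm (g y - g x) \<le> norm R + norm (y - x) * K"
        using norm_triangle_ineq[of R "g' (y - x)"] K(2)[of "y - x"] by (simp add: R_def)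
      finally have "norm (f' R) \<le> d * norm (y - x) + d * (norm R + norm (y - x) * K)"
        using d by simp
      then have "m * norm (f' R) \<le> m * (d * norm (y - x) + d * (norm R + norm (y - x) * K))"
        using m(1) by simp
      then have "norm R \<le> m * (d * norm (y - x) + d * (norm R + norm (y - x) * K))"
        using m(2)[of R] by linarith
      also have "\<dots> = (m * d) * norm R + (m * d * (K + 1)) * norm (y - x)"
        by (simp add: algebra_simps)
      also have "\<dots> \<le> 1 / 2 * norm R + e / 2 * norm (y - x)"
        using dm de by (intro add_mono mult_right_mono) auto
      finally show ?thesis
        by (simp add: R_def)
    qed
    then show "\<exists>d>0. \<forall>y. norm (y - x) < d \<longrightarrow> norm (g y - g x - g' (y - x)) \<le> e * norm (y - x)"
      using \<delta>2 \<delta>3 by (intro exI[of _ "min \<delta>2 \<delta>3"]) auto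
  qed
qed

subsection \<open>The operators on the group and on the covering\<close>

lemma bounded_linear_pair_mult: "bounded_linear (pair_mult P)"
proof -
  have "linear (pair_mult P)"
    by (rule linearI) (auto simp: pair_mult_def algebra_simps scaleR_conv_of_real split: prod.splits)
  then show ?thesis
    by (simp add: linear_conv_bounded_linear)
qed

text \<open>The curve M exp (t A), read in coordinates, is a continuous curve through p because p is
  off the seam. Its image under the immersion \<open>sl2_pair\<close> is explicit, so it has
  velocity v. The function h only agrees with g near p because h will itself be the result of a
  group operator.\<close>

lemma sl2_op_eq:
  assumes mexp: "\<And>t. mexp (t *\<^sub>R pair_mat A) = pair_mat (E t)"
    and det: "\<And>t. pair_det (E t) = 1"
    and E: "(E has_vector_derivative A) (at 0)"
    and E0: "E 0 = (1, 0)"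
    and v: "sl2_pair_deriv p v = pair_mult (sl2_pair p) A"
    and z: "\<bar>snd (snd p)\<bar> < pi"
    and h: "\<forall>\<^sub>F p' in nhds p. h p' = g p'"
    and g: "g differentiable (at p)"
  shows "sl2_op (pair_mat A) h p = frechet_derivative g (at p) v"
proof -
  define \<gamma> where "\<gamma> t = log_coord (pair_mult (sl2_pair p) (E t))" for t
  have one: "pair_mult P (1, 0) = P" for P
    by (auto simp: pair_mult_def split: prod.splits)
  have \<gamma>0: "\<gamma> 0 = p"
    unfolding \<gamma>_def E0 one using z by (intro log_coord_sl2_pair) auto
  have det': "pair_det (pair_mult (sl2_pair p) (E t)) = 1" for t
    by (simp add: pair_det_mult pair_det_sl2_pair det)
  have coord: "sl2_coord (sl2_map p ** mexp (t *\<^sub>R pair_mat A)) = \<gamma> t" for t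
    unfolding mexp sl2_map_eq pair_mat_mult \<gamma>_def by (intro sl2_coord_eq det')
  have "fst (sl2_pair p) \<notin> \<real>\<^sub>\<le>\<^sub>0"
  proof
    assume "fst (sl2_pair p) \<in> \<real>\<^sub>\<le>\<^sub>0"
    moreover obtain x y z where p: "p = (x, y, z)"
      by (cases p)
    moreover have "cosh_sqrt (x\<^sup>2 + y\<^sup>2) > 0"
      by (simp add: cosh_sqrt_pos)
    ultimately have "cos z \<le> 0" "sin z = 0"
      by (auto simp: sl2_pair_def complex_nonpos_Reals_iff mult_le_0_iff)
    then have "z = 0"
      using z sin_eq_0_pi[of z] by (auto simp: p abs_less_iff)
    then show False
      using \<open>cos z \<le> 0\<close> by simp
  qed
  then have log: "isCont log_coord (pair_mult (sl2_pair p) (E 0))"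
    unfolding E0 one by (rule isCont_log_coord)
  have "isCont (\<lambda>t. pair_mult (sl2_pair p) (E t)) 0"
    by (rule bounded_linear.isCont[OF bounded_linear_pair_mult has_vector_derivative_continuous[OF E]])
  then have cont: "isCont \<gamma> 0"
    unfolding \<gamma>_def[abs_def] by (rule isCont_o2) (rule log)
  have "((\<lambda>t. sl2_pair (\<gamma> t)) has_derivative (\<lambda>t. sl2_pair_deriv p (t *\<^sub>R v))) (at 0)"
  proof -
    have "((\<lambda>t. pair_mult (sl2_pair p) (E t)) has_derivative (\<lambda>t. pair_mult (sl2_pair p) (t *\<^sub>R A))) (at 0)"
      by (rule bounded_linear.has_derivative[OF bounded_linear_pair_mult E[unfolded has_vector_derivative_def]])
    moreover have "pair_mult (sl2_pair p) (t *\<^sub>R A) = sl2_pair_deriv p (t *\<^sub>R v)" for t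
      by (simp add: v linear_scale[OF has_derivative_linear[OF has_derivative_sl2_pair]]
          linear_scale[OF bounded_linear.linear[OF bounded_linear_pair_mult]])
    ultimately show ?thesis
      by (simp only: \<gamma>_def sl2_pair_log_coord[OF det'])
  qed
  then have d\<gamma>: "(\<gamma> has_derivative (\<lambda>t. t *\<^sub>R v)) (at 0)"
    by (rule has_derivative_lift_immersion[where f = sl2_pair and f' = "sl2_pair_deriv p", rotated 2])
      (simp_all only: \<gamma>0 has_derivative_sl2_pair inj_sl2_pair_deriv cont
        bounded_linear_scaleR_left)
  have g': "(g has_derivative frechet_derivative g (at p)) (at (\<gamma> 0))"
    using g frechet_derivative_works \<gamma>0 by metis
  have "((\<lambda>t. g (\<gamma> t)) has_derivative (\<lambda>t. frechet_derivative g (at p) (t *\<^sub>R v))) (at 0)"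
    using has_derivative_compose[OF d\<gamma> g'] .
  then have "((\<lambda>t. g (\<gamma> t)) has_real_derivative frechet_derivative g (at p) v) (at 0)"
    unfolding has_field_derivative_def
    by (rule has_derivative_eq_rhs)
      (simp add: fun_eq_iff linear_scale[OF linear_frechet_derivative[OF g]] mult.commute)
  moreover have "\<forall>\<^sub>F t in nhds 0. h (\<gamma> t) = g (\<gamma> t)"
  proof -
    have "(\<gamma> \<longlongrightarrow> p) (nhds 0)"
      using cont \<gamma>0 by (metis continuous_at_imp_continuous_at_within isCont_def tendsto_at_iff_tendsto_nhds)
    then show ?thesis
      by (rule eventually_compose_filterlim[OF h])
  qed
  ultimately have "((\<lambda>t. h (\<gamma> t)) has_real_derivative frechet_derivative g (at p) v) (at 0)"
    by (subst DERIV_cong_ev[OF refl _ refl]) auto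
  then show ?thesis
    by (simp add: sl2_op_def coord DERIV_imp_deriv)
qed

lemma sl2_op_horizontal:
  assumes "\<bar>snd (snd p)\<bar> < pi" "\<forall>\<^sub>F p' in nhds p. h p' = g p'" "g differentiable (at p)"
  shows "sl2_op (pair_mat (0, a)) h p = frechet_derivative g (at p) (horizontal_field a 1 p)"
proof (rule sl2_op_eq[OF _ _ _ _ sl2_pair_deriv_horizontal_field assms])
  define E where "E t = (complex_of_real (cosh_sqrt ((cmod (t *\<^sub>R a))\<^sup>2)),
    sinhc_sqrt ((cmod (t *\<^sub>R a))\<^sup>2) * (t *\<^sub>R a))" for t
  show "mexp (t *\<^sub>R pair_mat (0, a)) = pair_mat (E t)" for t
    using mexp_horizontal[of "t *\<^sub>R a"] unfolding pair_mat_scaleR E_def by simp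
  show "pair_det (E t) = 1" for t
    using cosh_sqrt_sinhc_sqrt[of "(cmod (t *\<^sub>R a))\<^sup>2"] unfolding E_def pair_det_def
    by (simp add: norm_mult power_mult_distrib mult_ac)
  show "E 0 = (1, 0)"
    by (simp add: E_def cosh_sqrt_0)
  \<comment> \<open>The square of cmod (t a) is of second order at t = 0, so the velocity of E comes
    from \<open>sinhc_sqrt 0 = 1\<close> alone.\<close>
  have q: "((\<lambda>t. (cmod (t *\<^sub>R a))\<^sup>2) has_derivative (\<lambda>h. 0)) (at 0)"
    by (auto simp: power_mult_distrib intro!: derivative_eq_intros)
  note C = has_derivative_real_compose[OF DERIV_cosh_sqrt q]
  note S = has_derivative_real_compose[OF DERIV_sinhc_sqrt q]
  show "(E has_vector_derivative (0, a)) (at 0)"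
    unfolding E_def has_vector_derivative_def
    by (rule has_derivative_eq_rhs[OF has_derivative_Pair[OF has_derivative_of_real[OF C]
        has_derivative_mult[OF has_derivative_of_real[OF S] has_derivative_scaleR_left[OF has_derivative_ident]]]])
      (auto simp: fun_eq_iff sinhc_sqrt_0)
qed

lemma sl2_op_vertical:
  assumes "\<bar>snd (snd p)\<bar> < pi" "g differentiable (at p)"
  shows "sl2_op (pair_mat (\<i>, 0)) g p = frechet_derivative g (at p) (0, 0, 1)"
proof (rule sl2_op_eq[where E = "\<lambda>t. (cis t, 0)"])
  show "mexp (t *\<^sub>R pair_mat (\<i>, 0)) = pair_mat (cis t, 0)" for t
    using mexp_vertical[of t] by (simp add: mat_eq_pair_mat)
  show "((\<lambda>t. (cis t, 0)) has_vector_derivative (\<i>, 0)) (at 0)"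
    unfolding has_vector_derivative_def
    by (auto intro!: derivative_eq_intros)
  show "sl2_pair_deriv p (0, 0, 1) = pair_mult (sl2_pair p) (\<i>, 0)"
    by (simp add: sl2_pair_deriv_def sl2_pair_def pair_mult_def Let_def scaleR_conv_of_real
      mult_ac case_prod_unfold flip: zero_complex.code)
qed (use assms in \<open>auto simp: pair_det_def\<close>)

subsection \<open>Dilations\<close>

definition dilation :: "real \<Rightarrow> heis \<Rightarrow> heis" where
  "dilation r = (\<lambda>(x, y, z). (r * x, r * y, r\<^sup>2 * z))"

text \<open>The flow of D at time (ln c) / 2 scales x, y by sqrt c and z by c.\<close>

lemma conj_dil_eq:
  assumes "c > 0"
  shows "conj_dil c T f p = T (\<lambda>p. f (dilation (sqrt c) p)) (dilation (1 / sqrt c) p)"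
proof -
  have e: "exp (ln c / 2) = sqrt c" "exp (- (ln c / 2)) = 1 / sqrt c"
    using assms by (simp_all add: ln_sqrt[symmetric] exp_minus inverse_eq_divide)
  have "exp (- ln c) = 1 / c"
    using assms by (simp add: exp_minus inverse_eq_divide)
  then show ?thesis
    using assms e
    by (simp add: conj_dil_def exp_dil_def dilation_def case_prod_unfold power_divide)
qed

lemma bounded_linear_dilation: "bounded_linear (dilation r)"
proof -
  have "linear (dilation r)"
    by (rule linearI) (auto simp: dilation_def algebra_simps split: prod.splits)
  then show ?thesis
    by (simp add: linear_conv_bounded_linear)
qed

lemma dilation_dilation: "r \<noteq> 0 \<Longrightarrow> dilation r (dilation (1 / r) p) = p"
  by (auto simp: dilation_def power_divide split: prod.splits)

lemma has_derivative_dilation_compose: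
  assumes "f differentiable (at p)" and "r \<noteq> 0"
  shows "((\<lambda>p. f (dilation r p)) has_derivative (\<lambda>v. frechet_derivative f (at p) (dilation r v)))
    (at (dilation (1 / r) p))"
proof -
  have "(f has_derivative frechet_derivative f (at p)) (at (dilation r (dilation (1 / r) p)))"
    using assms frechet_derivative_works by (metis dilation_dilation)
  then show ?thesis
    by (rule has_derivative_compose[OF bounded_linear_imp_has_derivative[OF bounded_linear_dilation]])
qed

lemma frechet_derivative_dilation_compose:
  assumes "f differentiable (at p)" and "r \<noteq> 0"
  shows "frechet_derivative (\<lambda>p. f (dilation r p)) (at (dilation (1 / r) p)) v
    = frechet_derivative f (at p) (dilation r v)"
  using frechet_derivative_at[OF has_derivative_dilation_compose[OF assms]] by metis

text \<open>Horizontal components are scaled by s * (1 / s) = 1, the vertical one by s / s^2 = 1 /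
  s, which cancels the factor s that m inherits from v. In the correction terms of w, the vector v
  occurs twice and leaves s^2.\<close>

lemma horizontal_field_dilation:
  assumes "s > 0"
  shows "s *\<^sub>R dilation (1 / s) (horizontal_field a 1 (dilation s p)) = horizontal_field a s p"
proof -
  obtain x y z where p: "p = (x, y, z)"
    by (cases p)
  have q: "(s * x)\<^sup>2 + (s * y)\<^sup>2 = s\<^sup>2 * (x\<^sup>2 + y\<^sup>2)"
    by (simp add: power_mult_distrib algebra_simps)
  have v: "Complex (s * x) (s * y) = s *\<^sub>R Complex x y"
    by (simp add: complex_eq_iff)
  show ?thesis
    using assms
    by (simp add: p dilation_def horizontal_field_def Let_def q v power_one mult.assoc)
      (simp add: field_simps power2_eq_square)
qed

lemma conj_dil_cover_horizontal:
  assumes c: "c > 0" and f: "f differentiable (at p)"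
  shows "1 / sqrt c * conj_dil c (cover_op (pair_mat (0, a))) f p
    = frechet_derivative f (at p) (horizontal_field a (1 / sqrt c) p)"
proof -
  let ?D = "frechet_derivative f (at p)"
  let ?h = "dilation (sqrt c) (horizontal_field a 1 (dilation (1 / sqrt c) p))"
  have r: "sqrt c \<noteq> 0"
    using c by simp
  have "1 / sqrt c * conj_dil c (cover_op (pair_mat (0, a))) f p = 1 / sqrt c * ?D ?h"
    by (simp only: conj_dil_eq[OF c] cover_op_def field_op_def cover_field_horizontal
        frechet_derivative_dilation_compose[OF f r])
  also have "\<dots> = ?D ((1 / sqrt c) *\<^sub>R ?h)"
    by (simp only: linear_scale[OF linear_frechet_derivative[OF f]] real_scaleR_def)
  also have "(1 / sqrt c) *\<^sub>R ?h = horizontal_field a (1 / sqrt c) p"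
    using horizontal_field_dilation[of "1 / sqrt c" a p] c by simp
  finally show ?thesis .
qed

lemma conj_dil_cover_vertical:
  assumes c: "c > 0" and f: "f differentiable (at p)"
  shows "1 / c * conj_dil c (cover_op (pair_mat (\<i>, 0))) f p = frechet_derivative f (at p) (0, 0, 1)"
proof -
  have r: "sqrt c \<noteq> 0"
    using c by simp
  have "dilation (sqrt c) (0, 0, 1) = c *\<^sub>R (0, 0, 1)"
    using c by (simp add: dilation_def)
  then have "conj_dil c (cover_op (pair_mat (\<i>, 0))) f p = c * frechet_derivative f (at p) (0, 0, 1)"
    by (simp only: conj_dil_eq[OF c] cover_op_def field_op_def cover_field_vertical
        frechet_derivative_dilation_compose[OF f r] linear_scale[OF linear_frechet_derivative[OF f]]
        real_scaleR_def)
  then show ?thesis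
    using c by simp
qed

lemma abs_dilation_less_pi:
  assumes "c > 0" and "\<bar>snd (snd p)\<bar> < c * pi"
  shows "\<bar>snd (snd (dilation (1 / sqrt c) p))\<bar> < pi"
  using assms by (auto simp: dilation_def case_prod_unfold power_divide abs_mult field_simps)

lemma conj_dil_sl2_horizontal:
  assumes c: "c > 0" and f: "f differentiable (at p)" and z: "\<bar>snd (snd p)\<bar> < c * pi"
    and h: "\<forall>\<^sub>F p' in nhds p. h p' = f p'"
  shows "1 / sqrt c * conj_dil c (sl2_op (pair_mat (0, a))) h p
    = frechet_derivative f (at p) (horizontal_field a (1 / sqrt c) p)"
proof -
  let ?p = "dilation (1 / sqrt c) p"
  have "isCont (dilation (sqrt c)) ?p"
    using bounded_linear_dilation linear_continuous_at by blast
  then have "(dilation (sqrt c) \<longlongrightarrow> dilation (sqrt c) ?p) (nhds ?p)"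
    by (simp only: isCont_def tendsto_at_iff_tendsto_nhds)
  moreover have "dilation (sqrt c) ?p = p"
    using c by (simp add: dilation_dilation)
  ultimately have "(dilation (sqrt c) \<longlongrightarrow> p) (nhds ?p)"
    by (simp only:)
  then have "\<forall>\<^sub>F p' in nhds ?p. h (dilation (sqrt c) p') = f (dilation (sqrt c) p')"
    by (rule eventually_compose_filterlim[OF h])
  moreover have "(\<lambda>p. f (dilation (sqrt c) p)) differentiable (at ?p)"
    using has_derivative_dilation_compose[OF f, of "sqrt c"] c differentiable_def by fastforce
  ultimately have "sl2_op (pair_mat (0, a)) (\<lambda>p. h (dilation (sqrt c) p)) ?p
      = frechet_derivative (\<lambda>p. f (dilation (sqrt c) p)) (at ?p) (horizontal_field a 1 ?p)"
    using abs_dilation_less_pi[OF c z] by (intro sl2_op_horizontal)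
  \<comment> \<open>Before the dilation is undone both operators have the same value at the dilated
    point, so the computation on the covering is reused.\<close>
  then show ?thesis
    using conj_dil_cover_horizontal[OF c f, of a]
    by (simp only: conj_dil_eq[OF c] cover_op_def field_op_def cover_field_horizontal)
qed

lemma conj_dil_sl2_vertical:
  assumes c: "c > 0" and f: "f differentiable (at p)" and z: "\<bar>snd (snd p)\<bar> < c * pi"
  shows "1 / c * conj_dil c (sl2_op (pair_mat (\<i>, 0))) f p = frechet_derivative f (at p) (0, 0, 1)"
proof -
  let ?p = "dilation (1 / sqrt c) p"
  have "(\<lambda>p. f (dilation (sqrt c) p)) differentiable (at ?p)"
    using has_derivative_dilation_compose[OF f, of "sqrt c"] c differentiable_def by fastforce
  then have "sl2_op (pair_mat (\<i>, 0)) (\<lambda>p. f (dilation (sqrt c) p)) ?p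
      = frechet_derivative (\<lambda>p. f (dilation (sqrt c) p)) (at ?p) (0, 0, 1)"
    using abs_dilation_less_pi[OF c z] by (intro sl2_op_vertical)
  then show ?thesis
    using conj_dil_cover_vertical[OF c f]
    by (simp only: conj_dil_eq[OF c] cover_op_def field_op_def cover_field_vertical)
qed

subsection \<open>Functions of class C1 depending on a parameter\<close>

text \<open>Differentiability is required only in the point, since the limit in the parameter needs
  no rate. One field applied to a smooth function stays in this class; a second application still
  gives a jointly continuous function.\<close>

definition param_C1 :: "(real \<Rightarrow> heis \<Rightarrow> real) \<Rightarrow> bool" where
  "param_C1 H \<longleftrightarrow> continuous_on UNIV (\<lambda>x. H (fst x) (snd x)) \<and>
     (\<exists>H'. (\<forall>s p. (H s has_derivative H' s p) (at p)) \<and>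
           (\<forall>e. continuous_on UNIV (\<lambda>x. H' (fst x) (snd x) e)))"

lemma param_C1I:
  assumes "\<And>s p. (H s has_derivative H' s p) (at p)"
    and "continuous_on UNIV (\<lambda>x. H (fst x) (snd x))"
    and "\<And>e. continuous_on UNIV (\<lambda>x. H' (fst x) (snd x) e)"
  shows "param_C1 H"
  using assms unfolding param_C1_def by blast

lemma param_C1E:
  assumes "param_C1 H"
  obtains H' where "\<And>s p. (H s has_derivative H' s p) (at p)"
    and "continuous_on UNIV (\<lambda>x. H (fst x) (snd x))"
    and "\<And>e. continuous_on UNIV (\<lambda>x. H' (fst x) (snd x) e)"
  using assms unfolding param_C1_def by blast

named_theorems param_C1_intros

lemma param_C1_parameter [param_C1_intros]:
  assumes "continuous_on UNIV \<phi>"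
  shows "param_C1 (\<lambda>s p. \<phi> s)"
proof (rule param_C1I)
  show "continuous_on UNIV (\<lambda>x::real \<times> heis. \<phi> (fst x))"
    by (rule continuous_on_compose2[OF assms]) (intro continuous_intros, simp)
qed (rule has_derivative_const, rule continuous_on_const)

lemma param_C1_coordinates [param_C1_intros]:
  "param_C1 (\<lambda>s p. fst p)" "param_C1 (\<lambda>s p. fst (snd p))" "param_C1 (\<lambda>s p. snd (snd p))"
proof -
  have L: "param_C1 (\<lambda>s. L)" if "bounded_linear L" for L
  proof (rule param_C1I)
    show "(L has_derivative L) (at p)" for p
      by (rule bounded_linear_imp_has_derivative[OF that])
    show "continuous_on UNIV (\<lambda>x::real \<times> heis. L (snd x))"
      by (rule continuous_on_compose2[OF linear_continuous_on[OF that]]) (intro continuous_intros, rule subset_UNIV)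
  qed (rule continuous_on_const)
  show "param_C1 (\<lambda>s p. fst p)" "param_C1 (\<lambda>s p. fst (snd p))" "param_C1 (\<lambda>s p. snd (snd p))"
    by (rule L, intro bounded_linear_fst bounded_linear_snd bounded_linear_fst_comp bounded_linear_snd_comp)+
qed

lemma param_C1_add [param_C1_intros]:
  assumes "param_C1 F" "param_C1 G"
  shows "param_C1 (\<lambda>s p. F s p + G s p)"
proof -
  obtain F' where F: "\<And>s p. (F s has_derivative F' s p) (at p)"
    "continuous_on UNIV (\<lambda>x. F (fst x) (snd x))" "\<And>e. continuous_on UNIV (\<lambda>x. F' (fst x) (snd x) e)"
    using assms(1) by (rule param_C1E) blast
  obtain G' where G: "\<And>s p. (G s has_derivative G' s p) (at p)"
    "continuous_on UNIV (\<lambda>x. G (fst x) (snd x))" "\<And>e. continuous_on UNIV (\<lambda>x. G' (fst x) (snd x) e)"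
    using assms(2) by (rule param_C1E) blast
  show ?thesis
    by (rule param_C1I, rule has_derivative_add[OF F(1) G(1)]) (intro continuous_intros F G)+
qed

lemma param_C1_mult [param_C1_intros]:
  assumes "param_C1 F" "param_C1 G"
  shows "param_C1 (\<lambda>s p. F s p * G s p)"
proof -
  obtain F' where F: "\<And>s p. (F s has_derivative F' s p) (at p)"
    "continuous_on UNIV (\<lambda>x. F (fst x) (snd x))" "\<And>e. continuous_on UNIV (\<lambda>x. F' (fst x) (snd x) e)"
    using assms(1) by (rule param_C1E) blast
  obtain G' where G: "\<And>s p. (G s has_derivative G' s p) (at p)"
    "continuous_on UNIV (\<lambda>x. G (fst x) (snd x))" "\<And>e. continuous_on UNIV (\<lambda>x. G' (fst x) (snd x) e)"
    using assms(2) by (rule param_C1E) blast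
  show ?thesis
    by (rule param_C1I, rule has_derivative_mult[OF F(1) G(1)]) (intro continuous_intros F G)+
qed

lemma param_C1_diff [param_C1_intros]:
  assumes "param_C1 F" "param_C1 G"
  shows "param_C1 (\<lambda>s p. F s p - G s p)"
  using param_C1_add[OF assms(1) param_C1_mult[OF param_C1_parameter[of "\<lambda>_. -1"] assms(2)]]
  by simp

text \<open>The set \<open>A\<close> allows reciprocals, whose argument is only known to be
  positive.\<close>

lemma param_C1_compose:
  assumes "param_C1 F" and A: "\<And>s p. F s p \<in> A"
    and \<phi>: "\<And>q. q \<in> A \<Longrightarrow> (\<phi> has_real_derivative \<phi>' q) (at q)" and \<phi>': "continuous_on A \<phi>'"
  shows "param_C1 (\<lambda>s p. \<phi> (F s p))"
proof -
  obtain F' where F: "\<And>s p. (F s has_derivative F' s p) (at p)"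
    "continuous_on UNIV (\<lambda>x. F (fst x) (snd x))" "\<And>e. continuous_on UNIV (\<lambda>x. F' (fst x) (snd x) e)"
    using assms(1) by (rule param_C1E) blast
  have "continuous_on A \<phi>"
    by (rule DERIV_continuous_on, rule has_field_derivative_at_within, rule \<phi>)
  then have "continuous_on UNIV (\<lambda>x. \<phi> (F (fst x) (snd x)))"
    by (rule continuous_on_compose2[OF _ F(2)]) (use A in auto)
  moreover have "continuous_on UNIV (\<lambda>x. \<phi>' (F (fst x) (snd x)))"
    by (rule continuous_on_compose2[OF \<phi>' F(2)]) (use A in auto)
  ultimately show ?thesis
    by (intro param_C1I[where H' = "\<lambda>s p h. \<phi>' (F s p) * F' s p h"] has_derivative_real_compose[OF \<phi>] A F
        continuous_on_mult)
qed

lemma continuous_on_sinhc_sqrt: "continuous_on UNIV sinhc_sqrt"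
  by (rule DERIV_continuous_on, rule has_field_derivative_at_within, rule DERIV_sinhc_sqrt)

lemma continuous_on_sinhc_sqrt': "continuous_on UNIV sinhc_sqrt'"
proof -
  obtain d where "\<And>q. (sinhc_sqrt' has_real_derivative d q) (at q)"
    using DERIV_sinhc_sqrt' by blast
  then show ?thesis
    by (rule DERIV_continuous_on[OF has_field_derivative_at_within])
qed

text \<open>Written in real components, the field is a polynomial in s, the coordinates, cos and sin
  of 2 s^2 z, and C, S, T, 1 / C, 1 / S at q \<ge> 0, where C and S are positive.\<close>

lemma param_C1_horizontal_field:
  shows "param_C1 (\<lambda>s p. fst (horizontal_field a s p))"
    and "param_C1 (\<lambda>s p. fst (snd (horizontal_field a s p)))"
    and "param_C1 (\<lambda>s p. snd (snd (horizontal_field a s p)))"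
proof -
  define q where "q s p = s\<^sup>2 * ((fst p)\<^sup>2 + (fst (snd p))\<^sup>2)" for s :: real and p :: heis
  define b1 where "b1 s p = Re a * cos (2 * s\<^sup>2 * snd (snd p)) + Im a * sin (2 * s\<^sup>2 * snd (snd p))"
    for s :: real and p :: heis
  define b2 where "b2 s p = Im a * cos (2 * s\<^sup>2 * snd (snd p)) - Re a * sin (2 * s\<^sup>2 * snd (snd p))"
    for s :: real and p :: heis
  define m1 where "m1 s p = fst p * b1 s p + fst (snd p) * b2 s p" for s and p :: heis
  define m2 where "m2 s p = fst p * b2 s p - fst (snd p) * b1 s p" for s and p :: heis
  define C where "C s p = cosh_sqrt (q s p)" for s p
  define S where "S s p = sinhc_sqrt (q s p)" for s p
  define T where "T s p = sinhc_sqrt' (q s p)" for s p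
  have pos: "C s p > 0" "S s p > 0" for s p
    by (simp_all add: C_def S_def q_def cosh_sqrt_pos sinhc_sqrt_pos)
  have q: "param_C1 q"
    unfolding q_def[abs_def] power2_eq_square by (intro param_C1_intros continuous_intros)
  have C: "param_C1 C"
    unfolding C_def[abs_def]
    by (rule param_C1_compose[OF q UNIV_I DERIV_cosh_sqrt]) (intro continuous_intros continuous_on_sinhc_sqrt, simp)
  have S: "param_C1 S"
    unfolding S_def[abs_def]
    by (rule param_C1_compose[OF q UNIV_I DERIV_sinhc_sqrt continuous_on_sinhc_sqrt'])
  obtain d where "\<And>q. (sinhc_sqrt' has_real_derivative d q) (at q)" "continuous_on UNIV d"
    using DERIV_sinhc_sqrt' by blast
  then have T: "param_C1 T"
    unfolding T_def[abs_def] by (rule param_C1_compose[OF q UNIV_I])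
  have inv: "param_C1 (\<lambda>s p. 1 / F s p)" if "param_C1 F" "\<And>s p. F s p > 0" for F
  proof (rule param_C1_compose[OF that(1)])
    show "F s p \<in> {0<..}" for s p
      using that(2) by simp
    show "((\<lambda>x. 1 / x) has_real_derivative - (1 / q\<^sup>2)) (at q)" if "q \<in> {0<..}" for q :: real
      using that by (auto intro!: derivative_eq_intros simp: power2_eq_square)
    show "continuous_on {0<..} (\<lambda>q::real. - (1 / q\<^sup>2))"
      by (intro continuous_intros) auto
  qed
  note iC = inv[OF C pos(1)] and iS = inv[OF S pos(2)]
  have z: "param_C1 (\<lambda>s p. 2 * s\<^sup>2 * snd (snd p))"
    by (intro param_C1_intros continuous_intros)
  have cos: "param_C1 (\<lambda>s p. cos (2 * s\<^sup>2 * snd (snd p)))"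
    by (rule param_C1_compose[OF z, of UNIV]) (auto intro!: derivative_eq_intros continuous_intros)
  have sin: "param_C1 (\<lambda>s p. sin (2 * s\<^sup>2 * snd (snd p)))"
    by (rule param_C1_compose[OF z, of UNIV]) (auto intro!: derivative_eq_intros continuous_intros)
  have b1: "param_C1 b1" and b2: "param_C1 b2"
    unfolding b1_def[abs_def] b2_def[abs_def] by (intro param_C1_intros cos sin continuous_intros)+
  have m1: "param_C1 m1" and m2: "param_C1 m2"
    unfolding m1_def[abs_def] m2_def[abs_def] by (intro param_C1_intros b1 b2)+
  have H: "horizontal_field a s p =
     (C s p * (1 / S s p) * b1 s p - 2 * s\<^sup>2 * (T s p * (1 / S s p) * m1 s p) * fst p
        + s\<^sup>2 * (S s p * (1 / C s p) * m2 s p) * fst (snd p),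
      C s p * (1 / S s p) * b2 s p - 2 * s\<^sup>2 * (T s p * (1 / S s p) * m1 s p) * fst (snd p)
        - s\<^sup>2 * (S s p * (1 / C s p) * m2 s p) * fst p,
      S s p * (1 / C s p) * m2 s p)" for s p
  proof -
    have b: "a * cis (- (2 * s\<^sup>2 * snd (snd p))) = Complex (b1 s p) (b2 s p)"
      by (simp add: complex_eq_iff b1_def b2_def)
    have m: "cnj (Complex (fst p) (fst (snd p))) * Complex (b1 s p) (b2 s p) = Complex (m1 s p) (m2 s p)"
      by (simp add: complex_eq_iff m1_def m2_def)
    show ?thesis
      by (simp only: horizontal_field_def case_prod_unfold Let_def b m q_def[symmetric]
          C_def[symmetric] S_def[symmetric] T_def[symmetric]) simp
  qed
  show "param_C1 (\<lambda>s p. fst (horizontal_field a s p))"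
    unfolding H fst_conv by (intro param_C1_intros C S T iC iS b1 m1 m2 continuous_intros)
  show "param_C1 (\<lambda>s p. fst (snd (horizontal_field a s p)))"
    unfolding H fst_conv snd_conv by (intro param_C1_intros C S T iC iS b2 m1 m2 continuous_intros)
  show "param_C1 (\<lambda>s p. snd (snd (horizontal_field a s p)))"
    unfolding H snd_conv by (intro param_C1_intros C S iC m2)
qed

text \<open>Reduces a derivative in a direction that moves with the parameter and the point to fixed
  directions, the form in which \<open>Ck\<close> and \<open>param_C1\<close> supply
  continuity.\<close>

lemma linear_heis_expand:
  assumes "linear (D :: heis \<Rightarrow> real)"
  shows "D w = fst w * D (1, 0, 0) + fst (snd w) * D (0, 1, 0) + snd (snd w) * D (0, 0, 1)"
proof -
  have "w = fst w *\<^sub>R (1, 0, 0) + fst (snd w) *\<^sub>R (0, 1, 0) + snd (snd w) *\<^sub>R (0, 0, 1)"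
    by (cases w) simp
  then show ?thesis
    using linear_add[OF assms] linear_scale[OF assms] real_scaleR_def by metis
qed

lemma smooth_differentiable: "smooth f \<Longrightarrow> f differentiable (at p)"
  unfolding smooth_def by (metis Ck.simps(2))

lemma param_C1_directional_derivative:
  assumes "smooth f"
  shows "param_C1 (\<lambda>s p. frechet_derivative f (at p) v)"
proof -
  let ?g = "\<lambda>p. frechet_derivative f (at p) v"
  have "Ck (Suc (Suc 0)) f"
    using assms smooth_def by blast
  then have g: "?g differentiable (at p)" "continuous_on UNIV (\<lambda>p. frechet_derivative ?g (at p) e)" for p e
    unfolding Ck.simps by blast+
  then have "continuous_on UNIV ?g"
    by (intro continuous_at_imp_continuous_on ballI differentiable_imp_continuous_within)
  then have "continuous_on UNIV (\<lambda>x. ?g (snd x))"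
    by (rule continuous_on_compose2) (auto intro: continuous_intros)
  moreover have "continuous_on UNIV (\<lambda>x. frechet_derivative ?g (at (snd x)) e)" for e
    by (rule continuous_on_compose2[OF g(2)]) (auto intro: continuous_intros)
  moreover have "(?g has_derivative frechet_derivative ?g (at p)) (at p)" for p
    using g(1) frechet_derivative_works by blast
  ultimately show ?thesis
    by (intro param_C1I[where H' = "\<lambda>s p. frechet_derivative ?g (at p)"])
qed

lemma param_C1_apply_horizontal:
  assumes "smooth f"
  shows "param_C1 (\<lambda>s p. frechet_derivative f (at p) (horizontal_field a s p))"
  by (subst linear_heis_expand[OF linear_frechet_derivative[OF smooth_differentiable[OF assms]]])
    (intro param_C1_intros param_C1_horizontal_field param_C1_directional_derivative assms)

text \<open>The outer field of a square uses up the one derivative that \<open>param_C1\<close>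
  offers.\<close>

lemma continuous_on_apply_horizontal:
  assumes "param_C1 F"
  shows "continuous_on UNIV
    (\<lambda>x. frechet_derivative (F (fst x)) (at (snd x)) (horizontal_field a (fst x) (snd x)))"
proof -
  obtain F' where F: "\<And>s p. (F s has_derivative F' s p) (at p)"
    "\<And>e. continuous_on UNIV (\<lambda>x. F' (fst x) (snd x) e)"
    using assms by (rule param_C1E) blast
  have D: "frechet_derivative (F s) (at p) = F' s p" for s p
    using frechet_derivative_at[OF F(1)] by simp
  have W: "continuous_on UNIV (\<lambda>x. fst (horizontal_field a (fst x) (snd x)))"
    "continuous_on UNIV (\<lambda>x. fst (snd (horizontal_field a (fst x) (snd x))))"
    "continuous_on UNIV (\<lambda>x. snd (snd (horizontal_field a (fst x) (snd x))))"
    using param_C1_horizontal_field unfolding param_C1_def by auto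
  show ?thesis
    unfolding D by (subst linear_heis_expand[OF has_derivative_linear[OF F(1)]])
      (intro continuous_intros F W)
qed

subsection \<open>The limits\<close>

lemma eventually_dist_less_compact_support:
  fixes G :: "real \<Rightarrow> 'a::metric_space \<Rightarrow> real"
  assumes G: "continuous_on UNIV (\<lambda>x. G (fst x) (snd x))" and K: "compact K"
    and G0: "\<And>s p. p \<notin> K \<Longrightarrow> G s p = 0" and e: "e > 0"
  shows "\<forall>\<^sub>F c in at_top. \<forall>p. dist (G (1 / sqrt c) p) (G 0 p) < e"
proof -
  have "uniformly_continuous_on ({0..1} \<times> K) (\<lambda>x. G (fst x) (snd x))"
    using G K by (intro compact_uniformly_continuous compact_Times) (auto intro: continuous_on_subset)
  then obtain d where d: "d > 0"
    "\<And>x y. x \<in> {0..1} \<times> K \<Longrightarrow> y \<in> {0..1} \<times> K \<Longrightarrow> dist y x < d \<Longrightarrow>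
       dist (G (fst y) (snd y)) (G (fst x) (snd x)) < e"
    using e unfolding uniformly_continuous_on_def by metis
  have "((\<lambda>c::real. 1 / sqrt c) \<longlongrightarrow> 0) at_top"
    by (intro tendsto_divide_0[OF tendsto_const] filterlim_at_top_imp_at_infinity sqrt_at_top)
  \<comment> \<open>The bound 1 keeps the parameter in [0, 1]; the bound d controls the distance
    from (0, p) to (1 / sqrt c, p).\<close>
  then have "\<forall>\<^sub>F c in at_top. 1 / sqrt c < min d 1"
    using d(1) by (intro order_tendstoD(2)) auto
  with eventually_gt_at_top[of 0] show ?thesis
  proof eventually_elim
    case (elim c)
    show ?case
    proof
      fix p
      show "dist (G (1 / sqrt c) p) (G 0 p) < e"
        using d(2)[of "(0, p)" "(1 / sqrt c, p)"] elim e G0[of p]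
        by (cases "p \<in> K") (auto simp: dist_Pair_Pair)
    qed
  qed
qed

lemma frechet_derivative_eq_0_outside:
  assumes "closed K" and "\<And>p. p \<notin> K \<Longrightarrow> f p = 0" and "p \<notin> K"
  shows "frechet_derivative f (at p) v = 0"
proof -
  have "(f has_derivative (\<lambda>v. 0)) (at p)"
    by (rule has_derivative_transform_within_open[of "\<lambda>_. 0" _ _ UNIV "- K"])
      (use assms in auto)
  then show ?thesis
    by (metis frechet_derivative_at)
qed

lemma outside_support: "p \<notin> closure {p. f p \<noteq> 0} \<Longrightarrow> f p = 0"
  using closure_subset[of "{p. f p \<noteq> 0}"] by auto

lemma horizontal_limit:
  assumes f: "smooth f" "compact_support f" and e: "e > 0"
  shows "\<forall>\<^sub>F c in at_top. \<forall>p. dist (frechet_derivative f (at p) (horizontal_field a (1 / sqrt c) p))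
     (frechet_derivative f (at p) (horizontal_field a 0 p)) < e"
proof (rule eventually_dist_less_compact_support)
  show "continuous_on UNIV (\<lambda>x. frechet_derivative f (at (snd x)) (horizontal_field a (fst x) (snd x)))"
    using param_C1_apply_horizontal[OF f(1)] by (auto simp: param_C1_def)
  show "compact (closure {p. f p \<noteq> 0})"
    using f(2) by (simp add: compact_support_def)
  show "frechet_derivative f (at p) (horizontal_field a s p) = 0" if "p \<notin> closure {p. f p \<noteq> 0}" for s p
    using outside_support[of _ f] that by (rule frechet_derivative_eq_0_outside[OF closed_closure])
qed (rule e)

definition horizontal_square :: "complex \<Rightarrow> (heis \<Rightarrow> real) \<Rightarrow> real \<Rightarrow> heis \<Rightarrow> real" where
  "horizontal_square a f s p =
     frechet_derivative (\<lambda>p. frechet_derivative f (at p) (horizontal_field a s p)) (at p) (horizontal_field a s p)"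

lemma horizontal_square_limit:
  assumes f: "smooth f" "compact_support f" and e: "e > 0"
  shows "\<forall>\<^sub>F c in at_top. \<forall>p. dist
     (horizontal_square a f (1 / sqrt c) p + horizontal_square b f (1 / sqrt c) p)
     (horizontal_square a f 0 p + horizontal_square b f 0 p) < e"
proof (rule eventually_dist_less_compact_support)
  let ?K = "closure {p. f p \<noteq> 0}"
  have C: "continuous_on UNIV (\<lambda>x. horizontal_square a f (fst x) (snd x))" for a
    using continuous_on_apply_horizontal[OF param_C1_apply_horizontal[OF f(1), of a], of a]
    by (simp only: horizontal_square_def)
  show "continuous_on UNIV (\<lambda>x. horizontal_square a f (fst x) (snd x) + horizontal_square b f (fst x) (snd x))"
    by (intro continuous_on_add C)
  show "compact ?K"
    using f(2) by (simp add: compact_support_def)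
  have D: "frechet_derivative f (at p) v = 0" if "p \<notin> ?K" for p v
    by (rule frechet_derivative_eq_0_outside[OF closed_closure outside_support[where f = f] that])
  have "horizontal_square a f s p = 0" if "p \<notin> ?K" for a s p
    unfolding horizontal_square_def
    by (rule frechet_derivative_eq_0_outside[OF closed_closure D that])
  then show "horizontal_square a f s p + horizontal_square b f s p = 0" if "p \<notin> ?K" for s p
    using that by simp
qed (rule e)

text \<open>All hyperbolic factors are evaluated at q = 0, where they equal 1; a = 1 and a = i give
  the two horizontal Heisenberg fields.\<close>

lemma horizontal_field_0:
  "horizontal_field a 0 (x, y, z) = (Re a, Im a, x * Im a - y * Re a)"
  by (simp add: horizontal_field_def Let_def cosh_sqrt_0 sinhc_sqrt_0)

section \<open>The operators expressed through the fields at s = 0 and s = 1 / sqrt c\<close>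

lemma X_heis_eq: "X_heis f p = frechet_derivative f (at p) (horizontal_field 1 0 p)"
  and Y_heis_eq: "Y_heis f p = frechet_derivative f (at p) (horizontal_field \<i> 0 p)"
  and Z_heis_eq: "Z_heis f p = frechet_derivative f (at p) (0, 0, 1)"
  by (cases p; simp add: X_heis_def Y_heis_def Z_heis_def field_op_def horizontal_field_0)+

lemma L_heis_eq: "L_heis f p = horizontal_square 1 f 0 p + horizontal_square \<i> f 0 p"
  by (simp add: L_heis_def sum_of_squares_def X_heis_eq[abs_def] Y_heis_eq[abs_def] horizontal_square_def)

lemma smooth_apply_horizontal_differentiable:
  "smooth f \<Longrightarrow> (\<lambda>p. frechet_derivative f (at p) (horizontal_field a s p)) differentiable (at p)"
  using param_C1_apply_horizontal unfolding param_C1_def differentiable_def by meson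

lemma X_cover_eq:
  "c > 0 \<Longrightarrow> f differentiable (at p) \<Longrightarrow>
    X_cover c f p = frechet_derivative f (at p) (horizontal_field 1 (1 / sqrt c) p)"
  and Y_cover_eq:
  "c > 0 \<Longrightarrow> f differentiable (at p) \<Longrightarrow>
    Y_cover c f p = frechet_derivative f (at p) (horizontal_field \<i> (1 / sqrt c) p)"
  unfolding X_cover_def Y_cover_def mat_eq_pair_mat by (rule conj_dil_cover_horizontal; assumption)+

lemma L_cover_eq:
  assumes "smooth f" "c > 0"
  shows "L_cover c f p = horizontal_square 1 f (1 / sqrt c) p + horizontal_square \<i> f (1 / sqrt c) p"
proof -
  have "X_cover c f = (\<lambda>p. frechet_derivative f (at p) (horizontal_field 1 (1 / sqrt c) p))"
    "Y_cover c f = (\<lambda>p. frechet_derivative f (at p) (horizontal_field \<i> (1 / sqrt c) p))"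
    using assms by (simp_all add: fun_eq_iff X_cover_eq Y_cover_eq smooth_differentiable)
  then show ?thesis
    using assms by (simp add: L_cover_def sum_of_squares_def X_cover_eq Y_cover_eq
        smooth_apply_horizontal_differentiable horizontal_square_def)
qed

lemma X_sl2_eq:
  "c > 0 \<Longrightarrow> f differentiable (at p) \<Longrightarrow> \<bar>snd (snd p)\<bar> < c * pi \<Longrightarrow> \<forall>\<^sub>F p' in nhds p. h p' = f p' \<Longrightarrow>
    X_sl2 c h p = frechet_derivative f (at p) (horizontal_field 1 (1 / sqrt c) p)"
  and Y_sl2_eq:
  "c > 0 \<Longrightarrow> f differentiable (at p) \<Longrightarrow> \<bar>snd (snd p)\<bar> < c * pi \<Longrightarrow> \<forall>\<^sub>F p' in nhds p. h p' = f p' \<Longrightarrow>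
    Y_sl2 c h p = frechet_derivative f (at p) (horizontal_field \<i> (1 / sqrt c) p)"
  unfolding X_sl2_def Y_sl2_def mat_eq_pair_mat by (rule conj_dil_sl2_horizontal; assumption)+

text \<open>The region where the first-order formulas hold is open, so they hold on a neighbourhood
  of p, which is what the outer field sees.\<close>

lemma L_sl2_eq:
  assumes "smooth f" "c > 0" "\<bar>snd (snd p)\<bar> < c * pi"
  shows "L_sl2 c f p = horizontal_square 1 f (1 / sqrt c) p + horizontal_square \<i> f (1 / sqrt c) p"
proof -
  have "open {p::heis. \<bar>snd (snd p)\<bar> < c * pi}"
    by (intro open_Collect_less continuous_intros)
  then have ev: "\<forall>\<^sub>F p' in nhds p. \<bar>snd (snd p')\<bar> < c * pi"
    using assms(3) eventually_nhds by blast
  then have "\<forall>\<^sub>F p' in nhds p. X_sl2 c f p' = frechet_derivative f (at p') (horizontal_field 1 (1 / sqrt c) p')"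
    by eventually_elim (use assms in \<open>simp add: X_sl2_eq smooth_differentiable\<close>)
  moreover from ev have "\<forall>\<^sub>F p' in nhds p. Y_sl2 c f p' = frechet_derivative f (at p') (horizontal_field \<i> (1 / sqrt c) p')"
    by eventually_elim (use assms in \<open>simp add: Y_sl2_eq smooth_differentiable\<close>)
  ultimately show ?thesis
    unfolding L_sl2_def sum_of_squares_def horizontal_square_def using assms
    by (simp add: X_sl2_eq[OF _ smooth_apply_horizontal_differentiable]
      Y_sl2_eq[OF _ smooth_apply_horizontal_differentiable])
qed

text \<open>For c > 1 the boxes stay strictly inside the fundamental domain, whose seam has moved
  out to height c pi under the dilation.\<close>

lemma sl2_box_interior:
  assumes "c > 1" "p \<in> sl2_box c"
  shows "\<bar>snd (snd p)\<bar> < c * pi"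
proof -
  have "\<bar>snd (snd p)\<bar> \<le> sqrt c * pi"
    using assms(2) by (auto simp: sl2_box_def)
  also have "sqrt c < c"
    using assms(1) by (simp add: real_less_lsqrt power2_eq_square)
  then have "sqrt c * pi < c * pi"
    by simp
  finally show ?thesis .
qed

section \<open>From the parameter s to uniform limits in c\<close>

lemma uniform_limit_dilated:
  assumes "\<And>e. e > 0 \<Longrightarrow> \<forall>\<^sub>F c in at_top. \<forall>p. dist (G (1 / sqrt c) p) (G 0 p) < e"
    and "\<And>c p. c > 0 \<Longrightarrow> F c p = G (1 / sqrt c) p" and "\<And>p. g p = G 0 p"
  shows "uniform_limit UNIV F g at_top"
  unfolding uniform_limit_iff
proof (intro allI impI)
  fix e :: real assume "e > 0"
  from assms(1)[OF this] eventually_gt_at_top[of 0]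
  show "\<forall>\<^sub>F c in at_top. \<forall>p\<in>UNIV. dist (F c p) (g p) < e"
    by eventually_elim (simp add: assms)
qed

lemma uniform_limit_on_boxes_dilated:
  assumes "\<And>e. e > 0 \<Longrightarrow> \<forall>\<^sub>F c in at_top. \<forall>p. dist (G (1 / sqrt c) p) (G 0 p) < e"
    and "\<And>c p. c > 0 \<Longrightarrow> \<bar>snd (snd p)\<bar> < c * pi \<Longrightarrow> F c p = G (1 / sqrt c) p"
    and "\<And>p. g p = G 0 p"
  shows "uniform_limit_on_boxes F g"
  unfolding uniform_limit_on_boxes_def
proof (intro allI impI)
  fix e :: real assume "e > 0"
  from assms(1)[OF this] eventually_gt_at_top[of 1]
  show "\<forall>\<^sub>F c in at_top. \<forall>p\<in>sl2_box c. dist (F c p) (g p) < e"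
  proof eventually_elim
    case (elim c)
    have "F c p = G (1 / sqrt c) p" if "p \<in> sl2_box c" for p
      using elim(2) by (intro assms(2) sl2_box_interior that) auto
    then show ?case
      using elim(1) assms(3) by metis
  qed
qed

theorem proposition3p14:
  fixes f :: "heis \<Rightarrow> real"
  assumes "smooth f" and "compact_support f"
  shows "uniform_limit_on_boxes (\<lambda>c. X_sl2 c f) (X_heis f)
       \<and> uniform_limit_on_boxes (\<lambda>c. Y_sl2 c f) (Y_heis f)
       \<and> uniform_limit_on_boxes (\<lambda>c. Z_sl2 c f) (Z_heis f)
       \<and> uniform_limit UNIV (\<lambda>c. X_cover c f) (X_heis f) at_top
       \<and> uniform_limit UNIV (\<lambda>c. Y_cover c f) (Y_heis f) at_top
       \<and> uniform_limit UNIV (\<lambda>c. Z_cover c f) (Z_heis f) at_top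
       \<and> uniform_limit_on_boxes (\<lambda>c. L_sl2 c f) (L_heis f)
       \<and> uniform_limit UNIV (\<lambda>c. L_cover c f) (L_heis f) at_top"
proof (intro conjI)
  note d = smooth_differentiable[OF assms(1)]
  note h = horizontal_limit[OF assms] and sq = horizontal_square_limit[OF assms]
  show "uniform_limit_on_boxes (\<lambda>c. X_sl2 c f) (X_heis f)"
    by (rule uniform_limit_on_boxes_dilated[OF h]) (auto simp: X_sl2_eq[OF _ d] X_heis_eq)
  show "uniform_limit_on_boxes (\<lambda>c. Y_sl2 c f) (Y_heis f)"
    by (rule uniform_limit_on_boxes_dilated[OF h]) (auto simp: Y_sl2_eq[OF _ d] Y_heis_eq)
  \<comment> \<open>The dilated vertical field is exactly the z-derivative for every c, so a
    constant G does.\<close>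
  show "uniform_limit_on_boxes (\<lambda>c. Z_sl2 c f) (Z_heis f)"
    by (rule uniform_limit_on_boxes_dilated[where G = "\<lambda>s. Z_heis f"])
      (auto simp: Z_heis_eq Z_sl2_def mat_eq_pair_mat conj_dil_sl2_vertical[OF _ d, simplified])
  show "uniform_limit UNIV (\<lambda>c. X_cover c f) (X_heis f) at_top"
    by (rule uniform_limit_dilated[OF h]) (auto simp: X_cover_eq[OF _ d] X_heis_eq)
  show "uniform_limit UNIV (\<lambda>c. Y_cover c f) (Y_heis f) at_top"
    by (rule uniform_limit_dilated[OF h]) (auto simp: Y_cover_eq[OF _ d] Y_heis_eq)
  show "uniform_limit UNIV (\<lambda>c. Z_cover c f) (Z_heis f) at_top"
    by (rule uniform_limit_dilated[where G = "\<lambda>s. Z_heis f"])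
      (auto simp: Z_heis_eq Z_cover_def mat_eq_pair_mat conj_dil_cover_vertical[OF _ d, simplified])
  show "uniform_limit_on_boxes (\<lambda>c. L_sl2 c f) (L_heis f)"
    by (rule uniform_limit_on_boxes_dilated[OF sq]) (auto simp: L_sl2_eq[OF assms(1)] L_heis_eq)
  show "uniform_limit UNIV (\<lambda>c. L_cover c f) (L_heis f) at_top"
    by (rule uniform_limit_dilated[OF sq]) (auto simp: L_cover_eq[OF assms(1)] L_heis_eq)
qed

end
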